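(* Let $m\geq2$ and let $$F(S_1,\ldots,S_n):=\sum_{k=0}^{m-1}\sum_{|\alpha|=k}S_\alpha\otimes A_{(\alpha)},\quad A_{(\alpha)}\in B(\mathcal{H}),$$ be a polynomial such that $F(0)\geq0$ and $\mathrm{Re}\,F(S_1,\ldots,S_n)\leq I$. Then $$\sum_{k=0}^{m-1}r^kw\left(A_{(\alpha)}^*:\ |\alpha|=k\right)\leq\|A_{(0)}\|+\|I-A_{(0)}\|$$ for any $r\in[0,t_m]$, where $t_m\in(0,1]$ is the solution of the equation $$\sum_{k=1}^{m-1}t^k\cos\frac{\pi}{\left[\frac{m-1}{k}\right]+2}=\frac12,$$ $[x]$ denoting the integer part of $x$. Moreover, $\{t_m\}_{m\ge2}$ is a strictly decreasing sequence which converges to $\frac13$.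
   Context: For $N\ge1$, $H_N$ is an $N$-dimensional complex Hilbert space with orthonormal basis $e_1,\dots,e_N$; $F^2(H_N)=\bigoplus_{k\ge0}H_N^{\otimes k}$ (with $H_N^{\otimes0}=\mathbb{C}1$) is the full Fock space and $S_i\varphi=e_i\otimes\varphi$, $i=1,\dots,N$, are the left creation operators on it. $\mathbb{F}_n^+$ is the unital free semigroup on $g_1,\dots,g_n$ with identity $g_0$; $|g_{i_1}\cdots g_{i_k}|=k$, $|g_0|=0$; $S_\alpha:=S_{i_1}\cdots S_{i_k}$ for $\alpha=g_{i_1}\cdots g_{i_k}$, $S_{g_0}:=I$. The numerical radius is $\omega(T):=\sup\{|\langle Th,h\rangle|:\|h\|=1\}$. The joint numerical radius of an $N$-tuple $(X_1,\dots,X_N)$ of bounded operators on a Hilbert space is $w(X_1,\dots,X_N):=\omega(S_1\otimes X_1^*+\cdots+S_N\otimes X_N^* )$, with $S_1,\dots,S_N$ the left creation operators on $F^2(H_N)$; $w(A_{(\alpha)}^*:|\alpha|=k)$ is the joint numerical radius of the $n^k$-tuple of operators $A_{(\alpha)}^*$, $|\alpha|=k$. $A_{(0)}:=A_{(g_0)}$, $F(0)\ge0$ means $A_{(0)}\ge0$; $\mathrm{Re}\,A=\frac12(A+A^* )$. *)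

theory Defs
  imports "HOL-Analysis.Analysis"
begin

section \<open>Complex Hilbert spaces\<close>

text \<open>The inner product is linear in the first and conjugate linear in the second argument.\<close>

class complex_inner = real_normed_vector +
  fixes scaleC :: "complex \<Rightarrow> 'a \<Rightarrow> 'a"  (infixr \<open>*\<^sub>C\<close> 75)
    and cinner :: "'a \<Rightarrow> 'a \<Rightarrow> complex"
  assumes scaleC_add_right: "a *\<^sub>C (x + y) = a *\<^sub>C x + a *\<^sub>C y"
    and scaleC_add_left: "(a + b) *\<^sub>C x = a *\<^sub>C x + b *\<^sub>C x"
    and scaleC_scaleC: "a *\<^sub>C b *\<^sub>C x = (a * b) *\<^sub>C x"
    and scaleR_scaleC: "r *\<^sub>R x = complex_of_real r *\<^sub>C x"
    and cinner_commute: "cinner x y = cnj (cinner y x)"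
    and cinner_add_left: "cinner (x + y) z = cinner x z + cinner y z"
    and cinner_scaleC_left: "cinner (a *\<^sub>C x) y = a * cinner x y"
    and norm_eq_sqrt_cinner: "norm x = sqrt (Re (cinner x x))"

class chilbert_space = complex_inner + complete_space

subclass (in chilbert_space) banach ..

instantiation complex :: chilbert_space
begin

definition scaleC_complex :: "complex \<Rightarrow> complex \<Rightarrow> complex"
  where "scaleC_complex a x = a * x"

definition cinner_complex :: "complex \<Rightarrow> complex \<Rightarrow> complex"
  where "cinner_complex x y = x * cnj y"

instance
  by standard
    (auto simp: scaleC_complex_def cinner_complex_def algebra_simps scaleR_conv_of_real
      cmod_def power2_eq_square)

end

definition bounded_clinear :: "('a::complex_inner \<Rightarrow> 'b::complex_inner) \<Rightarrow> bool"
  where "bounded_clinear T \<longleftrightarrow> bounded_linear T \<and> (\<forall>a x. T (a *\<^sub>C x) = a *\<^sub>C T x)"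

definition cadjoint :: "('a::complex_inner \<Rightarrow> 'a) \<Rightarrow> 'a \<Rightarrow> 'a"
  where "cadjoint T = (SOME T'. \<forall>x y. cinner (T x) y = cinner x (T' y))"

definition positive_op :: "('a::complex_inner \<Rightarrow> 'a) \<Rightarrow> bool"
  where "positive_op T \<longleftrightarrow> (\<forall>x. cinner (T x) x \<in> \<real>\<^sub>\<ge>\<^sub>0)"


section \<open>The spaces of square-summable families\<close>

text \<open>
  \<open>ell2 I\<close> is the Hilbert direct sum of copies of the Hilbert space \<^typ>\<open>'a\<close> indexed by the set
  \<open>I\<close>, its elements being extended by zero outside \<open>I\<close>. For \<^typ>\<open>complex\<close>-valued families it is
  the Hilbert space with orthonormal basis indexed by \<open>I\<close>, and in general it is the Hilbert space
  tensor product of that space with \<^typ>\<open>'a\<close>: the elementary tensor of \<open>\<phi>\<close> and \<open>h\<close> is the family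
  \<open>\<lambda>i. \<phi> i *\<^sub>C h\<close>.
\<close>

definition ell2 :: "'i set \<Rightarrow> ('i \<Rightarrow> 'a::complex_inner) set"
  where "ell2 I = {f. (\<forall>i. i \<notin> I \<longrightarrow> f i = 0) \<and> (\<lambda>i. (norm (f i))\<^sup>2) summable_on I}"

definition ell2_inner :: "'i set \<Rightarrow> ('i \<Rightarrow> 'a::complex_inner) \<Rightarrow> ('i \<Rightarrow> 'a) \<Rightarrow> complex"
  where "ell2_inner I f g = (\<Sum>\<^sub>\<infinity>i\<in>I. cinner (f i) (g i))"

definition ell2_norm :: "'i set \<Rightarrow> ('i \<Rightarrow> 'a::complex_inner) \<Rightarrow> real"
  where "ell2_norm I f = sqrt (\<Sum>\<^sub>\<infinity>i\<in>I. (norm (f i))\<^sup>2)"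

text \<open>Only the values of the adjoint on \<open>ell2 I\<close> are determined (and meaningful).\<close>

definition ell2_adjoint ::
    "'i set \<Rightarrow> (('i \<Rightarrow> 'a::complex_inner) \<Rightarrow> 'i \<Rightarrow> 'a) \<Rightarrow> ('i \<Rightarrow> 'a) \<Rightarrow> 'i \<Rightarrow> 'a"
  where "ell2_adjoint I T = (SOME T'.
    (\<forall>g\<in>ell2 I. T' g \<in> ell2 I) \<and>
    (\<forall>f\<in>ell2 I. \<forall>g\<in>ell2 I. ell2_inner I (T f) g = ell2_inner I f (T' g)))"

definition ell2_Re ::
    "'i set \<Rightarrow> (('i \<Rightarrow> 'a::complex_inner) \<Rightarrow> 'i \<Rightarrow> 'a) \<Rightarrow> ('i \<Rightarrow> 'a) \<Rightarrow> 'i \<Rightarrow> 'a"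
  where "ell2_Re I T f i = (1/2) *\<^sub>R (T f i + ell2_adjoint I T f i)"

definition ell2_le ::
    "'i set \<Rightarrow> (('i \<Rightarrow> 'a::complex_inner) \<Rightarrow> 'i \<Rightarrow> 'a) \<Rightarrow> (('i \<Rightarrow> 'a) \<Rightarrow> 'i \<Rightarrow> 'a) \<Rightarrow> bool"
  where "ell2_le I T U \<longleftrightarrow>
    (\<forall>f\<in>ell2 I. ell2_inner I (\<lambda>i. U f i - T f i) f \<in> \<real>\<^sub>\<ge>\<^sub>0)"

text \<open>
  The additional element \<open>0\<close> matters only if there are no unit vectors, that is, on the zero
  space, where the numerical radius is thereby \<open>0\<close>.
\<close>

definition numerical_radius ::
    "'i set \<Rightarrow> (('i \<Rightarrow> 'a::complex_inner) \<Rightarrow> 'i \<Rightarrow> 'a) \<Rightarrow> real"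
  where "numerical_radius I T =
    Sup (insert 0 {cmod (ell2_inner I (T h) h) |h. h \<in> ell2 I \<and> ell2_norm I h = 1})"

definition ell2_basis :: "'i \<Rightarrow> 'i \<Rightarrow> complex"
  where "ell2_basis j = (\<lambda>i. if i = j then 1 else 0)"

text \<open>
  The tensor product of a bounded operator \<open>T\<close> on the scalar space \<open>ell2 I\<close> with a bounded
  operator \<open>X\<close> on \<^typ>\<open>'a\<close>, in terms of the matrix entries \<open>T (ell2_basis j) i\<close> of \<open>T\<close>. The rows
  of this matrix are square-summable, hence the sum converges absolutely for \<open>f \<in> ell2 I\<close>.
\<close>

definition tensor_op ::
    "'i set \<Rightarrow> (('i \<Rightarrow> complex) \<Rightarrow> 'i \<Rightarrow> complex) \<Rightarrow> ('a::complex_inner \<Rightarrow> 'a) \<Rightarrow>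
      ('i \<Rightarrow> 'a) \<Rightarrow> 'i \<Rightarrow> 'a"
  where "tensor_op I T X f i = (\<Sum>\<^sub>\<infinity>j\<in>I. T (ell2_basis j) i *\<^sub>C X (f j))"


section \<open>Creation operators on the full Fock space\<close>

text \<open>
  Let \<open>J\<close> be a finite set with \<open>N\<close> elements, indexing the orthonormal basis \<open>e\<close> of the
  \<open>N\<close>-dimensional space. The \<open>k\<close>-th tensor power of this space has the orthonormal basis of the
  vectors \<open>e i\<^sub>1 \<otimes> \<dots> \<otimes> e i\<^sub>k\<close>, which are indexed by the lists of length \<open>k\<close> over \<open>J\<close>; the empty
  list corresponds to the vacuum vector. The full Fock space is therefore the scalar
  \<open>ell2 (lists J)\<close>, in which \<open>ell2_basis [i\<^sub>1, \<dots>, i\<^sub>k]\<close> is \<open>e i\<^sub>1 \<otimes> \<dots> \<otimes> e i\<^sub>k\<close>. Lists are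
  also the elements of the free semigroup, with the empty list as identity.
\<close>

text \<open>\<open>creation i \<phi>\<close> is \<open>e i \<otimes> \<phi>\<close>.\<close>

definition creation :: "'j \<Rightarrow> ('j list \<Rightarrow> complex) \<Rightarrow> 'j list \<Rightarrow> complex"
  where "creation i \<phi> w = (case w of [] \<Rightarrow> 0 | j # v \<Rightarrow> if j = i then \<phi> v else 0)"

primrec creation_word :: "'j list \<Rightarrow> ('j list \<Rightarrow> complex) \<Rightarrow> 'j list \<Rightarrow> complex"
  where
    "creation_word [] = id"
  | "creation_word (i # \<alpha>) = creation i \<circ> creation_word \<alpha>"

definition words :: "nat \<Rightarrow> nat \<Rightarrow> nat list set"
  where "words n k = {\<alpha> \<in> lists {1..n}. length \<alpha> = k}"

text \<open>
  The joint numerical radius of a finite tuple \<open>X\<close> of bounded operators, indexed by an arbitrary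
  finite set \<open>J\<close>. Here the Fock space is the one over a space of dimension \<open>card J\<close>.
\<close>

definition joint_numerical_radius :: "'j set \<Rightarrow> ('j \<Rightarrow> 'a::complex_inner \<Rightarrow> 'a) \<Rightarrow> real"
  where "joint_numerical_radius J X =
    numerical_radius (lists J)
      (\<lambda>f w. \<Sum>j\<in>J. tensor_op (lists J) (creation j) (cadjoint (X j)) f w)"

text \<open>The polynomial of degree less than \<open>m\<close> in the creation operators, with coefficients \<open>A\<close>.\<close>

definition fock_poly ::
    "nat \<Rightarrow> nat \<Rightarrow> (nat list \<Rightarrow> 'a::complex_inner \<Rightarrow> 'a) \<Rightarrow> (nat list \<Rightarrow> 'a) \<Rightarrow> nat list \<Rightarrow> 'a"
  where "fock_poly n m A f w =
    (\<Sum>k=0..m-1. \<Sum>\<alpha>\<in>words n k. tensor_op (lists {1..n}) (creation_word \<alpha>) (A \<alpha>) f w)"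

definition is_radius :: "nat \<Rightarrow> real \<Rightarrow> bool"
  where "is_radius m t \<longleftrightarrow> 0 < t \<and> t \<le> 1 \<and>
    (\<Sum>k=1..m-1. t ^ k * cos (pi / (\<lfloor>real (m - 1) / real k\<rfloor> + 2))) = 1/2"

definition radius :: "nat \<Rightarrow> real"
  where "radius m = (THE t. is_radius m t)"


section \<open>The tensor products with creation operators\<close>

lemma creation_word_apply:
  "creation_word \<alpha> \<phi> w = (if \<exists>v. w = \<alpha> @ v then \<phi> (drop (length \<alpha>) w) else 0)"
  by (induction \<alpha> arbitrary: w) (auto simp: creation_def split: list.split)

lemma scaleC_one [simp]: "1 *\<^sub>C x = x"
  by (metis of_real_1 scaleR_one scaleR_scaleC)

lemma scaleC_zero_left [simp]: "0 *\<^sub>C x = 0"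
  by (metis of_real_0 scaleR_zero_left scaleR_scaleC)

lemma tensor_op_creation_word:
  assumes "bounded_clinear X" and "\<And>v. v \<notin> lists J \<Longrightarrow> f v = 0"
  shows "tensor_op (lists J) (creation_word \<alpha>) X f w =
    (if \<exists>v. w = \<alpha> @ v then X (f (drop (length \<alpha>) w)) else 0)"
proof (cases "\<exists>v. w = \<alpha> @ v")
  case True
  then obtain v where w: "w = \<alpha> @ v" by blast
  have X0: "X 0 = 0"
    using assms(1) by (simp add: bounded_clinear_def linear_simps)
  have "tensor_op (lists J) (creation_word \<alpha>) X f w =
      (\<Sum>\<^sub>\<infinity>u\<in>lists J. (if v = u then 1 else 0) *\<^sub>C X (f u))"
    by (simp add: tensor_op_def creation_word_apply w ell2_basis_def)
  also have "\<dots> = (\<Sum>\<^sub>\<infinity>u\<in>{v}. X (f u))"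
    by (rule infsum_cong_neutral) (auto simp: assms(2) X0)
  finally show ?thesis
    by (simp add: w)
next
  case False
  then show ?thesis
    by (simp add: tensor_op_def creation_word_apply)
qed

lemma tensor_op_creation_word_elementary:
  assumes "bounded_clinear X" and "\<phi> \<in> ell2 (lists J)"
  shows "tensor_op (lists J) (creation_word \<alpha>) X (\<lambda>v. \<phi> v *\<^sub>C h) =
    (\<lambda>w. creation_word \<alpha> \<phi> w *\<^sub>C X h)"
proof
  fix w
  have "\<phi> v *\<^sub>C h = 0" if "v \<notin> lists J" for v
    using assms(2) that by (simp add: ell2_def)
  then show "tensor_op (lists J) (creation_word \<alpha>) X (\<lambda>v. \<phi> v *\<^sub>C h) w =
      creation_word \<alpha> \<phi> w *\<^sub>C X h"
    using assms(1)
    by (subst tensor_op_creation_word) (auto simp: creation_word_apply bounded_clinear_def)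
qed

end

theory Submission
  imports Defs
begin

text \<open>
  Rotating a vector by \<open>f w \<mapsto> exp (i s |w|) f w\<close> turns the hypothesis \<open>Re F \<le> I\<close> into the nonnegativity
  of a trigonometric polynomial whose \<open>j\<close>-th coefficient is the quadratic form of the
  \<open>j\<close>-homogeneous part of \<open>F\<close>. A vector of the Fock space over the words of length \<open>k\<close> can be
  viewed as a vector \<open>f\<close> of the original Fock space supported on the words whose length is a
  multiple of \<open>k\<close>; for such \<open>f\<close> only the frequencies divisible by \<open>k\<close> survive, and
  \<open>q = \<lfloor>(m - 1) / k\<rfloor>\<close> is the degree after rescaling. Fejer's inequality for the first
  coefficient then bounds the joint numerical radius of the \<open>k\<close>-homogeneous part by
  \<open>2 \<parallel>I - A\<^sub>0\<parallel> cos (\<pi> / (q + 2))\<close>, and the equation for \<open>t\<^sub>m\<close> is made for summing these bounds.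
\<close>

section \<open>Adjoints on Hilbert spaces\<close>

lemma cinner_add_right: "cinner x (y + z) = cinner x y + cinner x z"
  using arg_cong[OF cinner_add_left[of y z x], of cnj]
  by (simp add: cinner_commute[of x, symmetric])

lemma cinner_scaleC_right: "cinner x (a *\<^sub>C y) = cnj a * cinner x y"
  using arg_cong[OF cinner_scaleC_left[of a y x], of cnj]
  by (simp add: cinner_commute[of x, symmetric])

lemma cinner_self: "cinner x x = of_real ((norm x)\<^sup>2)"
proof -
  have "Re (cinner x x) \<ge> 0"
    using norm_eq_sqrt_cinner[of x] norm_ge_zero[of x] real_sqrt_ge_0_iff by metis
  then have "Re (cinner x x) = (norm x)\<^sup>2"
    by (simp add: norm_eq_sqrt_cinner)
  moreover have "Im (cinner x x) = 0"
    using arg_cong[OF cinner_commute[of x x], of Im] by simp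
  ultimately show ?thesis
    by (simp add: complex_eq_iff)
qed

lemma norm_scaleC: "norm (a *\<^sub>C x) = cmod a * norm x"
proof -
  have "complex_of_real ((norm (a *\<^sub>C x))\<^sup>2) = complex_of_real ((cmod a * norm x)\<^sup>2)"
    using complex_norm_square[of a]
    unfolding cinner_self[symmetric] cinner_scaleC_left cinner_scaleC_right
    by (simp add: cinner_self power_mult_distrib mult_ac)
  then show ?thesis
    by (simp only: of_real_eq_iff power2_eq_iff_nonneg norm_ge_zero mult_nonneg_nonneg)
qed

lemma norm_add_square:
  "(norm (x + y))\<^sup>2 = (norm x)\<^sup>2 + 2 * Re (cinner x y) + (norm (y::'a::complex_inner))\<^sup>2"
proof -
  have "complex_of_real ((norm (x + y))\<^sup>2) =
      of_real ((norm x)\<^sup>2) + (cinner x y + cnj (cinner x y)) + of_real ((norm y)\<^sup>2)"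
    unfolding cinner_self[symmetric] cinner_commute[of y x, symmetric]
    by (simp add: cinner_add_left cinner_add_right)
  also have "\<dots> = of_real ((norm x)\<^sup>2 + 2 * Re (cinner x y) + (norm y)\<^sup>2)"
    by (simp add: complex_add_cnj)
  finally show ?thesis
    by (simp only: of_real_eq_iff)
qed

lemma cinner_Cauchy_Schwarz: "cmod (cinner x y) \<le> norm x * norm y"
proof -
  have Re_le: "Re (cinner u y) \<le> norm u * norm y" for u :: 'a
  proof -
    have "(norm (u + y))\<^sup>2 \<le> (norm u + norm y)\<^sup>2"
      by (rule power_mono) (auto intro: norm_triangle_ineq)
    then show ?thesis
      by (simp add: norm_add_square power2_sum)
  qed
  define a where "a = cis (- Arg (cinner x y))"
  have "a * cinner x y = of_real (cmod (cinner x y))"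
    by (subst rcis_cmod_Arg[symmetric])
      (simp only: a_def rcis_def mult.left_commute[of "cis _"] cis_mult, simp)
  then have "cmod (cinner x y) = Re (cinner (a *\<^sub>C x) y)"
    by (simp add: cinner_scaleC_left)
  also have "\<dots> \<le> norm (a *\<^sub>C x) * norm y"
    by (rule Re_le)
  also have "\<dots> = norm x * norm y"
    by (simp add: norm_scaleC a_def)
  finally show ?thesis .
qed

lemma bounded_bilinear_cinner: "bounded_bilinear (cinner :: 'a::complex_inner \<Rightarrow> _)"
proof
  show "\<exists>K. \<forall>a b::'a. norm (cinner a b) \<le> norm a * norm b * K"
    by (rule exI[of _ 1]) (simp add: cinner_Cauchy_Schwarz)
qed (simp_all add: cinner_add_left cinner_add_right scaleR_scaleC cinner_scaleC_left
    cinner_scaleC_right scaleC_complex_def)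

interpretation cinner: bounded_bilinear "cinner :: 'a::complex_inner \<Rightarrow> _"
  by (rule bounded_bilinear_cinner)

lemma cinner_ext:
  assumes "\<And>x. cinner x y = cinner x z"
  shows "y = z"
  using assms[of "y - z"] cinner_self[of "y - z"] by (simp add: cinner.diff_right)

lemma linear_coefficient_zero:
  fixes a b :: real
  assumes "\<And>t. a * t + b * t\<^sup>2 \<ge> 0"
  shows "a = 0"
proof (rule ccontr)
  assume "a \<noteq> 0"
  define B where "B = \<bar>b\<bar> + 1"
  have "B > 0" "b \<le> B" "b < B"
    by (auto simp: B_def)
  have "a * (- a / B) + b * (- a / B)\<^sup>2 = (a / B)\<^sup>2 * (b - B)"
    using \<open>B > 0\<close> by (simp add: field_simps power2_eq_square)
  also have "\<dots> < 0"
    using \<open>B > 0\<close> \<open>b < B\<close> \<open>a \<noteq> 0\<close> by (intro mult_pos_neg) auto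
  finally show False
    using assms[of "- a / B"] by simp
qed

text \<open>The representing vector minimises the functional \<open>x \<mapsto> \<parallel>x\<parallel>\<^sup>2 / 2 - \<phi> x\<close>; minimising sequences
  converge by the parallelogram law.\<close>

lemma Riesz_real:
  fixes \<phi> :: "'a::chilbert_space \<Rightarrow> real"
  assumes "bounded_linear \<phi>"
  shows "\<exists>z. \<forall>x. \<phi> x = Re (cinner x z)"
proof -
  interpret \<phi>: bounded_linear \<phi> by fact
  define E where "E x = (norm x)\<^sup>2 / 2 - \<phi> x" for x
  have "E x \<ge> - (onorm \<phi>)\<^sup>2 / 2" for x
  proof -
    have "\<phi> x \<le> onorm \<phi> * norm x"
      using onorm[OF assms, of x] by simp
    then show ?thesis
      using zero_le_power2[of "norm x - onorm \<phi>"]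
      by (simp add: E_def power2_diff field_simps)
  qed
  then have bdd: "bdd_below (range E)"
    by (auto simp: bdd_below_def)
  define I where "I = Inf (range E)"
  have I_le: "I \<le> E x" for x
    unfolding I_def by (rule cInf_lower) (use bdd in auto)
  have close: "(norm (x - y))\<^sup>2 \<le> 4 * (E x + E y - 2 * I)" for x y
  proof -
    have "(norm ((1/2) *\<^sub>R (x + y)))\<^sup>2 = (norm (x + y))\<^sup>2 / 4"
      by (simp only: norm_scaleR power_mult_distrib) (simp add: power2_eq_square)
    moreover have "\<phi> ((1/2) *\<^sub>R (x + y)) = (\<phi> x + \<phi> y) / 2"
      by (simp only: \<phi>.scaleR \<phi>.add) simp
    ultimately have "E x + E y - 2 * E ((1/2) *\<^sub>R (x + y)) = (norm (x - y))\<^sup>2 / 4"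
      using norm_add_square[of x y] norm_add_square[of x "- y"]
      by (simp add: E_def cinner.minus_right)
    then show ?thesis
      using I_le[of "(1/2) *\<^sub>R (x + y)"] by simp
  qed
  have "\<exists>x. E x < I + inverse (real (Suc n))" for n
  proof -
    have "Inf (range E) < I + inverse (real (Suc n))"
      unfolding I_def by simp
    then show ?thesis
      using cInf_lessD by blast
  qed
  then have "\<exists>X. \<forall>n. E (X n) < I + inverse (real (Suc n))"
    by (intro choice) blast
  then obtain X where X: "\<And>n. E (X n) < I + inverse (real (Suc n))"
    by blast
  have "Cauchy X"
  proof (rule metric_CauchyI)
    fix e :: real
    assume "e > 0"
    then obtain M where M: "inverse (real (Suc M)) < e\<^sup>2 / 8"
      using reals_Archimedean[of "e\<^sup>2 / 8"] by auto
    have "dist (X p) (X q) < e" if "p \<ge> M" "q \<ge> M" for p q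
    proof -
      have le: "inverse (real (Suc p)) \<le> inverse (real (Suc M))"
        "inverse (real (Suc q)) \<le> inverse (real (Suc M))"
        using that by (auto intro: le_imp_inverse_le)
      have "(norm (X p - X q))\<^sup>2 < e\<^sup>2"
        using close[of "X p" "X q"] X[of p] X[of q] le M by argo
      then show ?thesis
        using \<open>e > 0\<close> by (simp add: dist_norm power2_less_imp_less)
    qed
    then show "\<exists>M. \<forall>m\<ge>M. \<forall>n\<ge>M. dist (X m) (X n) < e"
      by blast
  qed
  then obtain z where z: "X \<longlonglongrightarrow> z"
    using Cauchy_convergent convergent_def by blast
  have "(\<lambda>n. E (X n)) \<longlonglongrightarrow> E z"
    unfolding E_def by (intro tendsto_intros \<phi>.tendsto z) simp
  moreover have "(\<lambda>n. I + inverse (real (Suc n))) \<longlonglongrightarrow> I + 0"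
    by (intro tendsto_intros LIMSEQ_inverse_real_of_nat)
  ultimately have "E z \<le> I"
    using X by (intro LIMSEQ_le[of "\<lambda>n. E (X n)" "E z" "\<lambda>n. I + inverse (real (Suc n))"])
      (auto intro: less_imp_le)
  have "Re (cinner x z) - \<phi> x = 0" for x
  proof (rule linear_coefficient_zero)
    fix t :: real
    have "E (z + t *\<^sub>R x) - E z = (Re (cinner x z) - \<phi> x) * t + (norm x)\<^sup>2 / 2 * t\<^sup>2"
      using cinner_commute[of z x]
      by (simp add: E_def norm_add_square \<phi>.add \<phi>.scaleR cinner.scaleR_right power_mult_distrib
          field_simps)
    then show "(Re (cinner x z) - \<phi> x) * t + (norm x)\<^sup>2 / 2 * t\<^sup>2 \<ge> 0"
      using \<open>E z \<le> I\<close> I_le[of "z + t *\<^sub>R x"] by simp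
  qed
  then show ?thesis
    by (intro exI[of _ z]) simp
qed

lemma Riesz:
  fixes \<phi> :: "'a::chilbert_space \<Rightarrow> complex"
  assumes "bounded_linear \<phi>" and homogeneous: "\<And>a x. \<phi> (a *\<^sub>C x) = a * \<phi> x"
  shows "\<exists>z. \<forall>x. \<phi> x = cinner x z"
proof -
  obtain z where z: "Re (\<phi> x) = Re (cinner x z)" for x
    using Riesz_real[OF bounded_linear_compose[OF bounded_linear_Re assms(1)]] by auto
  have "Im (\<phi> x) = Im (cinner x z)" for x
    using z[of "\<i> *\<^sub>C x"] by (simp add: homogeneous cinner_scaleC_left)
  then show ?thesis
    using z by (auto simp: complex_eq_iff)
qed

lemma cinner_cadjoint:
  fixes T :: "'a::chilbert_space \<Rightarrow> 'a"
  assumes "bounded_clinear T"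
  shows "cinner (T x) y = cinner x (cadjoint T y)"
proof -
  have "\<forall>y. \<exists>z. \<forall>x. cinner (T x) y = cinner x z"
    using assms unfolding bounded_clinear_def
    by (intro allI Riesz bounded_linear_compose[OF cinner.bounded_linear_left])
      (auto simp: cinner_scaleC_left)
  then have "\<exists>T'. \<forall>y x. cinner (T x) y = cinner x (T' y)"
    by (rule choice)
  then have "\<exists>T'. \<forall>x y. cinner (T x) y = cinner x (T' y)"
    by blast
  from someI_ex[OF this] show ?thesis
    unfolding cadjoint_def by blast
qed

lemma cadjoint_cadjoint:
  fixes T :: "'a::chilbert_space \<Rightarrow> 'a"
  assumes "bounded_clinear T"
  shows "cadjoint (cadjoint T) = T"
proof
  fix y
  have adj: "cinner (cadjoint T x) y = cinner x (T y)" for x y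
    using cinner_cadjoint[OF assms, of y x]
    by (simp add: cinner_commute[of "cadjoint T x" y] cinner_commute[of x "T y"])
  then have "\<exists>T'. \<forall>x y. cinner (cadjoint T x) y = cinner x (T' y)"
    by blast
  from someI_ex[OF this] have "cinner (cadjoint T x) y = cinner x (cadjoint (cadjoint T) y)" for x y
    unfolding cadjoint_def[of "cadjoint T"] by blast
  with adj show "cadjoint (cadjoint T) y = T y"
    by (intro cinner_ext[of "cadjoint (cadjoint T) y"]) simp
qed

lemma norm_cadjoint_le:
  fixes T :: "'a::chilbert_space \<Rightarrow> 'a"
  assumes "bounded_clinear T"
  shows "norm (cadjoint T y) \<le> onorm T * norm y"
proof -
  have T: "bounded_linear T"
    using assms by (simp add: bounded_clinear_def)
  let ?u = "cadjoint T y"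
  have "norm ?u * norm ?u = cmod (cinner ?u ?u)"
    by (simp add: cinner_self power2_eq_square norm_mult)
  also have "\<dots> = cmod (cinner (T ?u) y)"
    by (simp add: cinner_cadjoint[OF assms])
  also have "\<dots> \<le> norm (T ?u) * norm y"
    by (rule cinner_Cauchy_Schwarz)
  also have "\<dots> \<le> onorm T * norm ?u * norm y"
    by (intro mult_right_mono onorm[OF T]) simp
  finally have "norm ?u * norm ?u \<le> (onorm T * norm y) * norm ?u"
    by (simp add: mult_ac)
  then show ?thesis
    using onorm_pos_le[OF T]
    by (cases "norm ?u = 0") (auto simp: mult_le_cancel_right)
qed

section \<open>Square-summable families\<close>

lemma ell2I:
  assumes "\<And>i. i \<notin> I \<Longrightarrow> f i = 0" "g summable_on I" "\<And>i. i \<in> I \<Longrightarrow> (norm (f i))\<^sup>2 \<le> g i"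
  shows "f \<in> ell2 I"
  using assms(1) summable_on_comparison_test[OF assms(2,3)] by (auto simp: ell2_def)

lemma ell2_summable: "f \<in> ell2 I \<Longrightarrow> (\<lambda>i. (norm (f i))\<^sup>2) summable_on I"
  by (simp add: ell2_def)

lemma ell2_outside: "f \<in> ell2 I \<Longrightarrow> i \<notin> I \<Longrightarrow> f i = 0"
  by (simp add: ell2_def)

lemma ell2_add:
  assumes "f \<in> ell2 I" "g \<in> ell2 I"
  shows "(\<lambda>i. f i + g i) \<in> ell2 I"
proof (rule ell2I)
  show "(\<lambda>i. 2 * (norm (f i))\<^sup>2 + 2 * (norm (g i))\<^sup>2) summable_on I"
    using assms by (intro summable_on_add summable_on_cmult_right ell2_summable)
  show "(norm (f i + g i))\<^sup>2 \<le> 2 * (norm (f i))\<^sup>2 + 2 * (norm (g i))\<^sup>2" for i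
  proof -
    have "(norm (f i + g i))\<^sup>2 \<le> (norm (f i) + norm (g i))\<^sup>2"
      by (intro power_mono norm_triangle_ineq) simp
    also have "\<dots> \<le> 2 * (norm (f i))\<^sup>2 + 2 * (norm (g i))\<^sup>2"
      using zero_le_power2[of "norm (f i) - norm (g i)"] by (simp add: power2_diff power2_sum)
    finally show ?thesis .
  qed
qed (use assms in \<open>simp add: ell2_outside\<close>)

lemma ell2_sum:
  assumes "\<And>x. x \<in> S \<Longrightarrow> F x \<in> ell2 I"
  shows "(\<lambda>i. \<Sum>x\<in>S. F x i) \<in> ell2 I"
  using assms
proof (induction S rule: infinite_finite_induct)
  case (insert x S)
  then show ?case
    by (simp add: ell2_add)
qed (auto simp: ell2_def)

lemma ell2_cinner_abs_summable:
  assumes "f \<in> ell2 I" "g \<in> ell2 I"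
  shows "(\<lambda>i. cmod (cinner (f i) (g i))) summable_on I"
proof (rule summable_on_comparison_test)
  show "(\<lambda>i. (norm (f i))\<^sup>2 + (norm (g i))\<^sup>2) summable_on I"
    using assms by (intro summable_on_add ell2_summable)
  show "cmod (cinner (f i) (g i)) \<le> (norm (f i))\<^sup>2 + (norm (g i))\<^sup>2" for i
    using cinner_Cauchy_Schwarz[of "f i" "g i"] zero_le_power2[of "norm (f i) - norm (g i)"]
      zero_le_power2[of "norm (f i)"] zero_le_power2[of "norm (g i)"]
    unfolding power2_diff by linarith
qed simp

lemmas ell2_cinner_summable = abs_summable_summable[OF ell2_cinner_abs_summable]

lemma ell2_norm_square: "(ell2_norm I f)\<^sup>2 = (\<Sum>\<^sub>\<infinity>i\<in>I. (norm (f i))\<^sup>2)"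
  by (simp add: ell2_norm_def infsum_nonneg)

lemma ell2_inner_self:
  assumes "f \<in> ell2 I"
  shows "ell2_inner I f f = of_real ((ell2_norm I f)\<^sup>2)"
proof -
  have "((\<lambda>i. complex_of_real ((norm (f i))\<^sup>2)) has_sum of_real (\<Sum>\<^sub>\<infinity>i\<in>I. (norm (f i))\<^sup>2)) I"
    by (intro has_sum_of_real has_sum_infsum ell2_summable assms)
  then show ?thesis
    by (simp add: ell2_inner_def cinner_self ell2_norm_square infsumI)
qed

lemma ell2_inner_commute: "ell2_inner I f g = cnj (ell2_inner I g f)"
  unfolding ell2_inner_def infsum_cnj[symmetric] cinner_commute[symmetric] ..

lemma ell2_inner_add_left:
  assumes "f \<in> ell2 I" "f' \<in> ell2 I" "g \<in> ell2 I"
  shows "ell2_inner I (\<lambda>i. f i + f' i) g = ell2_inner I f g + ell2_inner I f' g"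
  unfolding ell2_inner_def cinner_add_left
  using assms by (intro infsum_add ell2_cinner_summable)

lemma ell2_inner_scaleR_left:
  "ell2_inner I (\<lambda>i. r *\<^sub>R f i) g = of_real r * ell2_inner I f g"
  unfolding ell2_inner_def
  by (simp add: cinner.scaleR_left scaleR_conv_of_real infsum_cmult_right')

lemma ell2_scaleR:
  assumes "f \<in> ell2 I"
  shows "(\<lambda>i. r *\<^sub>R f i) \<in> ell2 I"
  using summable_on_cmult_right[OF ell2_summable[OF assms], of "r\<^sup>2"] ell2_outside[OF assms]
  by (auto simp: ell2_def power_mult_distrib)

lemma ell2_inner_sum_left:
  assumes "\<And>x. x \<in> S \<Longrightarrow> F x \<in> ell2 I" "g \<in> ell2 I"
  shows "ell2_inner I (\<lambda>i. \<Sum>x\<in>S. F x i) g = (\<Sum>x\<in>S. ell2_inner I (F x) g)"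
  using assms
proof (induction S rule: infinite_finite_induct)
  case (insert x S)
  then show ?case
    by (simp add: ell2_inner_add_left ell2_sum)
qed (auto simp: ell2_inner_def cinner.zero_left)

lemma ell2_inner_sum_right:
  assumes "\<And>x. x \<in> S \<Longrightarrow> F x \<in> ell2 I" "g \<in> ell2 I"
  shows "ell2_inner I g (\<lambda>i. \<Sum>x\<in>S. F x i) = (\<Sum>x\<in>S. ell2_inner I g (F x))"
  by (subst ell2_inner_commute, subst ell2_inner_sum_left[OF assms])
    (simp_all add: ell2_inner_commute[of I g])

lemma ell2_inner_Re_defect:
  assumes f: "f \<in> ell2 I" and T: "T f \<in> ell2 I"
    and adjoint: "\<exists>T'. (\<forall>g\<in>ell2 I. T' g \<in> ell2 I) \<and>
      (\<forall>f\<in>ell2 I. \<forall>g\<in>ell2 I. ell2_inner I (T f) g = ell2_inner I f (T' g))"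
  shows "Re (ell2_inner I (\<lambda>i. id f i - ell2_Re I T f i) f) =
    (ell2_norm I f)\<^sup>2 - Re (ell2_inner I (T f) f)"
proof -
  let ?T' = "ell2_adjoint I T"
  have T': "?T' f \<in> ell2 I" "ell2_inner I (T f) f = ell2_inner I f (?T' f)"
    using someI_ex[OF adjoint] f unfolding ell2_adjoint_def by blast+
  have "(\<lambda>i. id f i - ell2_Re I T f i) =
      (\<lambda>i. f i + ((- 1/2) *\<^sub>R T f i + (- 1/2) *\<^sub>R ?T' f i))"
    by (simp add: ell2_Re_def fun_eq_iff scaleR_add_right)
  then have "ell2_inner I (\<lambda>i. id f i - ell2_Re I T f i) f =
      ell2_inner I f f + (of_real (- 1/2) * ell2_inner I (T f) f +
        of_real (- 1/2) * ell2_inner I (?T' f) f)"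
    using f T T'(1)
    by (simp only: ell2_inner_add_left ell2_scaleR ell2_add ell2_inner_scaleR_left)
  also have "ell2_inner I (?T' f) f = cnj (ell2_inner I (T f) f)"
    unfolding T'(2) by (rule ell2_inner_commute)
  finally show ?thesis
    using f by (simp add: ell2_inner_self)
qed

section \<open>Shifts by words\<close>

definition word_shift :: "'j list \<Rightarrow> ('a::complex_inner \<Rightarrow> 'a) \<Rightarrow> ('j list \<Rightarrow> 'a) \<Rightarrow> 'j list \<Rightarrow> 'a"
  where "word_shift \<alpha> X f w = (if \<exists>v. w = \<alpha> @ v then X (f (drop (length \<alpha>) w)) else 0)"

definition word_form :: "'j set \<Rightarrow> 'j list \<Rightarrow> ('a::complex_inner \<Rightarrow> 'a) \<Rightarrow> ('j list \<Rightarrow> 'a) \<Rightarrow> complex"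
  where "word_form J \<alpha> X f = (\<Sum>\<^sub>\<infinity>v\<in>lists J. cinner (X (f v)) (f (\<alpha> @ v)))"

lemma word_shift_append [simp]: "word_shift \<alpha> X f (\<alpha> @ v) = X (f v)"
  by (simp add: word_shift_def)

lemma tensor_op_eq_word_shift:
  assumes "bounded_clinear X" "f \<in> ell2 (lists J)"
  shows "tensor_op (lists J) (creation_word \<alpha>) X f = word_shift \<alpha> X f"
  using tensor_op_creation_word[of X J f \<alpha>] assms by (auto simp: word_shift_def ell2_def)

lemma bounded_clinear_zero: "bounded_clinear X \<Longrightarrow> X 0 = 0"
  by (simp add: bounded_clinear_def linear_simps)

lemma word_shift_outside:
  assumes "bounded_clinear X" "f \<in> ell2 (lists J)" "w \<notin> (@) \<alpha> ` lists J"
  shows "word_shift \<alpha> X f w = 0"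
proof (cases "\<exists>v. w = \<alpha> @ v")
  case True
  then obtain v where v: "w = \<alpha> @ v"
    by blast
  with assms(3) have "v \<notin> lists J"
    by blast
  then show ?thesis
    by (simp add: v ell2_outside[OF assms(2)] bounded_clinear_zero[OF assms(1)])
qed (simp add: word_shift_def)

lemma word_shift_ell2:
  assumes X: "bounded_clinear X" and \<alpha>: "\<alpha> \<in> lists J" and f: "f \<in> ell2 (lists J)"
  shows "word_shift \<alpha> X f \<in> ell2 (lists J)"
proof -
  have zero: "word_shift \<alpha> X f w = 0" if "w \<notin> (@) \<alpha> ` lists J" for w
    using that by (rule word_shift_outside[OF X f])
  have "(\<lambda>v. (onorm X)\<^sup>2 * (norm (f v))\<^sup>2) summable_on lists J"
    by (intro summable_on_cmult_right ell2_summable f)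
  then have "(\<lambda>v. (norm (word_shift \<alpha> X f (\<alpha> @ v)))\<^sup>2) summable_on lists J"
  proof (rule summable_on_comparison_test)
    fix v
    have "norm (X (f v)) \<le> onorm X * norm (f v)"
      using X by (intro onorm) (simp add: bounded_clinear_def)
    then show "(norm (word_shift \<alpha> X f (\<alpha> @ v)))\<^sup>2 \<le> (onorm X)\<^sup>2 * (norm (f v))\<^sup>2"
      by (simp add: power_mono flip: power_mult_distrib)
  qed simp
  then have "(\<lambda>w. (norm (word_shift \<alpha> X f w))\<^sup>2) summable_on (@) \<alpha> ` lists J"
    by (subst summable_on_reindex) (auto simp: o_def inj_on_def)
  then have "(\<lambda>w. (norm (word_shift \<alpha> X f w))\<^sup>2) summable_on lists J"
    by (subst summable_on_cong_neutral[where T = "(@) \<alpha> ` lists J"]) (use \<alpha> in \<open>auto simp: zero\<close>)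
  moreover have "word_shift \<alpha> X f w = 0" if "w \<notin> lists J" for w
    using that \<alpha> by (intro zero) auto
  ultimately show ?thesis
    by (simp add: ell2_def)
qed

lemma ell2_inner_word_shift:
  assumes X: "bounded_clinear X" and \<alpha>: "\<alpha> \<in> lists J" and f: "f \<in> ell2 (lists J)"
  shows "ell2_inner (lists J) (word_shift \<alpha> X f) g = (\<Sum>\<^sub>\<infinity>v\<in>lists J. cinner (X (f v)) (g (\<alpha> @ v)))"
proof -
  have zero: "word_shift \<alpha> X f w = 0" if "w \<notin> (@) \<alpha> ` lists J" for w
    using that by (rule word_shift_outside[OF X f])
  have "ell2_inner (lists J) (word_shift \<alpha> X f) g =
      (\<Sum>\<^sub>\<infinity>w\<in>(@) \<alpha> ` lists J. cinner (word_shift \<alpha> X f w) (g w))"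
    unfolding ell2_inner_def
    by (rule infsum_cong_neutral) (use \<alpha> in \<open>auto simp: zero cinner.zero_left\<close>)
  also have "\<dots> = (\<Sum>\<^sub>\<infinity>v\<in>lists J. cinner (X (f v)) (g (\<alpha> @ v)))"
    by (subst infsum_reindex) (auto simp: o_def inj_on_def)
  finally show ?thesis .
qed

lemma ell2_left_translate:
  assumes X: "bounded_clinear (X :: 'a::chilbert_space \<Rightarrow> 'a)"
    and \<alpha>: "\<alpha> \<in> lists J" and g: "g \<in> ell2 (lists J)"
  shows "(\<lambda>v. if v \<in> lists J then cadjoint X (g (\<alpha> @ v)) else 0) \<in> ell2 (lists J)"
proof (rule ell2I)
  have "(\<lambda>w. (norm (g w))\<^sup>2) summable_on (@) \<alpha> ` lists J"
    by (rule summable_on_subset_banach[OF ell2_summable[OF g]]) (use \<alpha> in auto)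
  then have "(\<lambda>v. (norm (g (\<alpha> @ v)))\<^sup>2) summable_on lists J"
    by (subst (asm) summable_on_reindex) (auto simp: o_def inj_on_def)
  then show "(\<lambda>v. (onorm X)\<^sup>2 * (norm (g (\<alpha> @ v)))\<^sup>2) summable_on lists J"
    by (rule summable_on_cmult_right)
  show "(norm (if v \<in> lists J then cadjoint X (g (\<alpha> @ v)) else 0))\<^sup>2 \<le>
      (onorm X)\<^sup>2 * (norm (g (\<alpha> @ v)))\<^sup>2" if "v \<in> lists J" for v
    using that norm_cadjoint_le[OF X, of "g (\<alpha> @ v)"]
    by (simp add: power_mono flip: power_mult_distrib)
qed auto

lemma ell2_inner_word_shift_adjoint:
  assumes "bounded_clinear (X :: 'a::chilbert_space \<Rightarrow> 'a)" "\<alpha> \<in> lists J" "f \<in> ell2 (lists J)"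
  shows "ell2_inner (lists J) (word_shift \<alpha> X f) g =
    ell2_inner (lists J) f (\<lambda>v. if v \<in> lists J then cadjoint X (g (\<alpha> @ v)) else 0)"
  unfolding ell2_inner_word_shift[OF assms]
  unfolding ell2_inner_def
  by (intro infsum_cong) (simp add: cinner_cadjoint[OF assms(1)])

lemma words_in_lists: "\<alpha> \<in> words n k \<Longrightarrow> \<alpha> \<in> lists {1..n}"
  by (simp add: words_def)

context
  fixes n m :: nat and A :: "nat list \<Rightarrow> 'a::chilbert_space \<Rightarrow> 'a"
  assumes A: "\<And>k \<alpha>. k \<in> {0..m-1} \<Longrightarrow> \<alpha> \<in> words n k \<Longrightarrow> bounded_clinear (A \<alpha>)"
begin

lemma fock_poly_eq:
  assumes "f \<in> ell2 (lists {1..n})"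
  shows "fock_poly n m A f = (\<lambda>w. \<Sum>k=0..m-1. \<Sum>\<alpha>\<in>words n k. word_shift \<alpha> (A \<alpha>) f w)"
  unfolding fock_poly_def
  by (intro ext sum.cong refl) (simp only: tensor_op_eq_word_shift[OF A assms])

lemma fock_poly_ell2:
  assumes "f \<in> ell2 (lists {1..n})"
  shows "fock_poly n m A f \<in> ell2 (lists {1..n})"
  unfolding fock_poly_eq[OF assms]
  by (intro ell2_sum word_shift_ell2 assms) (rule A words_in_lists, assumption+)+

lemma ell2_inner_fock_poly:
  assumes "f \<in> ell2 (lists {1..n})" "g \<in> ell2 (lists {1..n})"
  shows "ell2_inner (lists {1..n}) (fock_poly n m A f) g =
    (\<Sum>k=0..m-1. \<Sum>\<alpha>\<in>words n k. ell2_inner (lists {1..n}) (word_shift \<alpha> (A \<alpha>) f) g)"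
proof -
  have shift: "word_shift \<alpha> (A \<alpha>) f \<in> ell2 (lists {1..n})"
    if "k \<in> {0..m-1}" "\<alpha> \<in> words n k" for k \<alpha>
    using that by (intro word_shift_ell2 assms(1)) (rule A words_in_lists, assumption+)+
  have "ell2_inner (lists {1..n}) (fock_poly n m A f) g =
      (\<Sum>k=0..m-1. ell2_inner (lists {1..n}) (\<lambda>w. \<Sum>\<alpha>\<in>words n k. word_shift \<alpha> (A \<alpha>) f w) g)"
    unfolding fock_poly_eq[OF assms(1)] by (intro ell2_inner_sum_left ell2_sum shift assms(2))
  also have "\<dots> =
      (\<Sum>k=0..m-1. \<Sum>\<alpha>\<in>words n k. ell2_inner (lists {1..n}) (word_shift \<alpha> (A \<alpha>) f) g)"
    by (intro sum.cong refl ell2_inner_sum_left shift assms(2))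
  finally show ?thesis .
qed

lemma fock_poly_adjoint_exists:
  "\<exists>T'. (\<forall>g\<in>ell2 (lists {1..n}). T' g \<in> ell2 (lists {1..n})) \<and>
    (\<forall>f\<in>ell2 (lists {1..n}). \<forall>g\<in>ell2 (lists {1..n}).
      ell2_inner (lists {1..n}) (fock_poly n m A f) g = ell2_inner (lists {1..n}) f (T' g))"
proof (intro exI conjI ballI)
  let ?B = "\<lambda>\<alpha> g v. if v \<in> lists {1..n} then cadjoint (A \<alpha>) (g (\<alpha> @ v)) else 0"
  let ?T = "\<lambda>g v. \<Sum>k=0..m-1. \<Sum>\<alpha>\<in>words n k. ?B \<alpha> g v"
  fix g :: "nat list \<Rightarrow> 'a" assume g: "g \<in> ell2 (lists {1..n})"
  have B: "?B \<alpha> g \<in> ell2 (lists {1..n})" if "k \<in> {0..m-1}" "\<alpha> \<in> words n k" for k \<alpha>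
    using that by (intro ell2_left_translate g) (rule A words_in_lists, assumption+)+
  then show "?T g \<in> ell2 (lists {1..n})"
    by (intro ell2_sum) auto
  fix f :: "nat list \<Rightarrow> 'a" assume f: "f \<in> ell2 (lists {1..n})"
  have "ell2_inner (lists {1..n}) f (?T g) =
      (\<Sum>k=0..m-1. ell2_inner (lists {1..n}) f (\<lambda>v. \<Sum>\<alpha>\<in>words n k. ?B \<alpha> g v))"
    by (intro ell2_inner_sum_right f ell2_sum B)
  also have "\<dots> = (\<Sum>k=0..m-1. \<Sum>\<alpha>\<in>words n k. ell2_inner (lists {1..n}) f (?B \<alpha> g))"
    by (intro sum.cong refl ell2_inner_sum_right f B)
  also have "\<dots> = ell2_inner (lists {1..n}) (fock_poly n m A f) g"
    unfolding ell2_inner_fock_poly[OF f g]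
    by (intro sum.cong refl ell2_inner_word_shift_adjoint[symmetric] f)
      (rule A words_in_lists, assumption+)+
  finally show "ell2_inner (lists {1..n}) (fock_poly n m A f) g =
      ell2_inner (lists {1..n}) f (?T g)" ..
qed

lemma word_forms_le_norm:
  assumes le: "ell2_le (lists {1..n}) (ell2_Re (lists {1..n}) (fock_poly n m A)) id"
    and f: "f \<in> ell2 (lists {1..n})"
  shows "Re (\<Sum>k=0..m-1. \<Sum>\<alpha>\<in>words n k. word_form {1..n} \<alpha> (A \<alpha>) f) \<le>
    (ell2_norm (lists {1..n}) f)\<^sup>2"
proof -
  have "(\<Sum>k=0..m-1. \<Sum>\<alpha>\<in>words n k. word_form {1..n} \<alpha> (A \<alpha>) f) =
      ell2_inner (lists {1..n}) (fock_poly n m A f) f"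
    unfolding ell2_inner_fock_poly[OF f f] word_form_def
    by (intro sum.cong refl ell2_inner_word_shift[symmetric] f)
      (rule A words_in_lists, assumption+)+
  moreover have "0 \<le> Re (ell2_inner (lists {1..n})
      (\<lambda>i. id f i - ell2_Re (lists {1..n}) (fock_poly n m A) f i) f)"
    using le f by (auto simp: ell2_le_def complex_nonneg_Reals_iff)
  ultimately show ?thesis
    using ell2_inner_Re_defect[OF f fock_poly_ell2[OF f] fock_poly_adjoint_exists] by simp
qed

end

section \<open>Fejer's inequality\<close>

lemma sum_roots_of_minus_one:
  assumes "1 \<le> l" "l < N"
  shows "(\<Sum>j<N. cis (real l * ((2 * real j + 1) * pi / real N))) = 0"
proof -
  define z where "z = cis (2 * pi * real l / real N)"
  have "(\<Sum>j<N. cis (real l * ((2 * real j + 1) * pi / real N))) =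
      (\<Sum>j<N. cis (real l * pi / real N) * z ^ j)"
    by (intro sum.cong refl) (simp add: z_def Complex.DeMoivre cis_mult field_simps)
  also have "\<dots> = cis (real l * pi / real N) * (\<Sum>j<N. z ^ j)"
    by (simp add: sum_distrib_left)
  also have "(\<Sum>j<N. z ^ j) = 0"
  proof -
    have "z \<noteq> 1"
    proof
      assume "z = 1"
      then obtain i :: int where i: "2 * pi * real l / real N = of_int i * (2 * pi)"
        unfolding z_def cis_conv_exp exp_eq_1 by auto
      then have "real l = of_int i * real N"
        using assms by (simp add: field_simps)
      then have "int l = i * int N"
        by (metis of_int_eq_iff of_int_mult of_int_of_nat_eq)
      then have "N dvd l"
        by (metis dvd_triv_right int_dvd_int_iff)
      with assms show False
        by (auto dest: dvd_imp_le)
    qed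
    moreover have "z ^ N = 1"
      using assms by (simp add: z_def Complex.DeMoivre cis_multiple_2pi)
    ultimately show ?thesis
      by (simp add: geometric_sum)
  qed
  finally show ?thesis by simp
qed

lemma cos_odd_multiple_le:
  assumes "j < N"
  shows "cos ((2 * real j + 1) * pi / real N) \<le> cos (pi / real N)"
proof (cases "(2 * real j + 1) * pi / real N \<le> pi")
  case True
  then show ?thesis
    using assms by (intro cos_monotone_0_pi_le) (auto intro!: divide_right_mono)
next
  case False
  have "(2 * real j + 1) * pi \<le> (2 * real N - 1) * pi"
    using assms by (intro mult_right_mono) auto
  then have "pi / real N \<le> 2 * pi - (2 * real j + 1) * pi / real N"
    using assms by (simp add: field_simps)
  then have "cos (2 * pi - (2 * real j + 1) * pi / real N) \<le> cos (pi / real N)"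
    using False by (intro cos_monotone_0_pi_le) auto
  then show ?thesis
    by (simp add: cos_diff)
qed

text \<open>The quadrature rule with the \<open>N = q + 2\<close> nodes \<open>\<theta> + (2 j + 1) \<pi> / N\<close> and the weights
  \<open>cos (\<pi> / N) - cos ((2 j + 1) \<pi> / N)\<close>, which are nonnegative,
  annihilates the frequencies \<open>2, \<dots>, q\<close>.\<close>

lemma Fejer_coefficient_bound:
  fixes c :: "nat \<Rightarrow> complex" and c0 :: real
  assumes "q \<ge> 1"
    and nonneg: "\<And>\<theta>. c0 - Re (\<Sum>l=1..q. cis (real l * \<theta>) * c l) \<ge> 0"
  shows "cmod (c 1) \<le> 2 * c0 * cos (pi / (real q + 2))"
proof -
  define N where "N = q + 2"
  define \<tau> where "\<tau> j = (2 * real j + 1) * pi / real N" for j :: nat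
  define C where "C = cos (pi / real N)"
  define \<theta> where "\<theta> = pi - Arg (c 1)"
  have "cis \<theta> * c 1 = - of_real (cmod (c 1))"
    by (subst rcis_cmod_Arg[symmetric])
      (simp only: \<theta>_def rcis_def mult.left_commute[of "cis _"] cis_mult, simp)
  have mean: "(\<Sum>j<N. cis (real l * \<tau> j)) = 0" if "1 \<le> l" "l < N" for l
    unfolding \<tau>_def using that by (rule sum_roots_of_minus_one)
  have moment: "(\<Sum>j<N. of_real (C - cos (\<tau> j)) * cis (real l * \<tau> j)) =
      (if l = 1 then - of_nat N / 2 else 0)" if "l \<in> {1..q}" for l
  proof -
    have product: "of_real (C - cos t) * cis (real l * t) =
        of_real C * cis (real l * t) - (cis (real (l + 1) * t) + cis (real (l - 1) * t)) / 2" for t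
      using that by (auto simp: complex_eq_iff algebra_simps of_nat_diff cos_add cos_diff sin_add sin_diff)
    have "(\<Sum>j<N. of_real (C - cos (\<tau> j)) * cis (real l * \<tau> j)) =
        of_real C * (\<Sum>j<N. cis (real l * \<tau> j)) -
        ((\<Sum>j<N. cis (real (l + 1) * \<tau> j)) + (\<Sum>j<N. cis (real (l - 1) * \<tau> j))) / 2"
      by (simp only: product sum_subtractf sum.distrib sum_distrib_left[symmetric]
          sum_divide_distrib[symmetric])
    also have "\<dots> = - (\<Sum>j<N. cis (real (l - 1) * \<tau> j)) / 2"
      using that mean[of l] mean[of "l + 1"] by (simp add: N_def del: sum.lessThan_Suc)
    also have "\<dots> = (if l = 1 then - of_nat N / 2 else 0)"
      using that mean[of "l - 1"] by (auto simp: N_def field_simps simp del: sum.lessThan_Suc)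
    finally show ?thesis .
  qed
  have cos_mean: "(\<Sum>j<N. cos (\<tau> j)) = 0"
    using arg_cong[OF mean[of 1], of Re] by (simp add: N_def del: sum.lessThan_Suc)
  have "0 \<le> (\<Sum>j<N. (C - cos (\<tau> j)) * (c0 - Re (\<Sum>l=1..q. cis (real l * (\<tau> j + \<theta>)) * c l)))"
    by (intro sum_nonneg mult_nonneg_nonneg nonneg)
      (simp add: C_def \<tau>_def cos_odd_multiple_le)
  also have "\<dots> = real N * C * c0 -
      (\<Sum>j<N. (C - cos (\<tau> j)) * Re (\<Sum>l=1..q. cis (real l * (\<tau> j + \<theta>)) * c l))"
    using cos_mean
    by (simp add: right_diff_distrib sum_subtractf flip: sum_distrib_right)
  also have "(\<Sum>j<N. (C - cos (\<tau> j)) * Re (\<Sum>l=1..q. cis (real l * (\<tau> j + \<theta>)) * c l)) =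
      Re (\<Sum>j<N. of_real (C - cos (\<tau> j)) * (\<Sum>l=1..q. cis (real l * (\<tau> j + \<theta>)) * c l))"
    by simp
  also have "(\<Sum>j<N. of_real (C - cos (\<tau> j)) * (\<Sum>l=1..q. cis (real l * (\<tau> j + \<theta>)) * c l)) =
      (\<Sum>l=1..q. \<Sum>j<N. of_real (C - cos (\<tau> j)) * (cis (real l * (\<tau> j + \<theta>)) * c l))"
    by (simp only: sum_distrib_left) (rule sum.swap)
  also have "\<dots> = (\<Sum>l=1..q. (\<Sum>j<N. of_real (C - cos (\<tau> j)) * cis (real l * \<tau> j)) *
      (cis (real l * \<theta>) * c l))"
    by (simp add: sum_distrib_right sum_distrib_left distrib_left mult_ac flip: cis_mult)
  also have "\<dots> = (\<Sum>l=1..q. if l = 1 then - of_nat N / 2 * (cis \<theta> * c 1) else 0)"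
    by (intro sum.cong refl) (subst moment, auto)
  also have "\<dots> = of_real (real N / 2 * cmod (c 1))"
    using \<open>q \<ge> 1\<close> \<open>cis \<theta> * c 1 = _\<close> by simp
  finally have "real N * (cmod (c 1)) \<le> real N * (2 * c0 * C)"
    by (simp add: mult_ac)
  then have "cmod (c 1) \<le> 2 * c0 * C"
    by (rule mult_left_le_imp_le) (simp add: N_def)
  then show ?thesis
    by (simp add: C_def N_def add.commute)
qed

section \<open>The radii\<close>

definition radius_coeff :: "nat \<Rightarrow> nat \<Rightarrow> real"
  where "radius_coeff m k = cos (pi / (\<lfloor>real (m - 1) / real k\<rfloor> + 2))"

definition radius_poly :: "nat \<Rightarrow> real \<Rightarrow> real"
  where "radius_poly m t = (\<Sum>k=1..m-1. t ^ k * radius_coeff m k)"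

lemma radius_coeff_eq: "radius_coeff m k = cos (pi / (real ((m - 1) div k) + 2))"
  by (simp add: radius_coeff_def floor_divide_of_nat_eq)

lemma radius_coeff_bounds:
  assumes "1 \<le> k" "k \<le> m - 1"
  shows "1/2 \<le> radius_coeff m k" "radius_coeff m k < 1"
proof -
  have q: "1 \<le> (m - 1) div k"
    using assms by (simp add: div_greater_zero_iff Suc_leI)
  have le: "pi / (real ((m - 1) div k) + 2) \<le> pi / 3"
    using q by (intro divide_left_mono) auto
  show "1/2 \<le> radius_coeff m k"
    unfolding radius_coeff_eq cos_60[symmetric] using le by (intro cos_monotone_0_pi_le) auto
  have "cos (pi / (real ((m - 1) div k) + 2)) < cos 0"
    using le by (intro cos_monotone_0_pi) (auto simp: divide_simps)
  then show "radius_coeff m k < 1"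
    by (simp add: radius_coeff_eq)
qed

lemma radius_coeff_mono:
  assumes "m \<le> m'"
  shows "radius_coeff m k \<le> radius_coeff m' k"
proof -
  have "(m - 1) div k \<le> (m' - 1) div k"
    using assms by (intro div_le_mono) auto
  then have "pi / (real ((m' - 1) div k) + 2) \<le> pi / (real ((m - 1) div k) + 2)"
    by (intro divide_left_mono) auto
  then show ?thesis
    unfolding radius_coeff_eq by (intro cos_monotone_0_pi_le) (auto simp: field_simps)
qed

lemma radius_coeff_tendsto: 
  assumes "k \<ge> 1"
  shows "(\<lambda>m. radius_coeff m k) \<longlonglongrightarrow> 1"
proof -
  have "filterlim (\<lambda>m. (m - 1) div k) at_top at_top"
  proof (subst filterlim_at_top, intro allI)
    fix Z
    show "\<forall>\<^sub>F m in sequentially. Z \<le> (m - 1) div k"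
      using eventually_ge_at_top[of "Z * k + 1"]
    proof eventually_elim
      case (elim m)
      then have "Z * k \<le> m - 1"
        by simp
      then show ?case
        using assms by (simp add: less_eq_div_iff_mult_less_eq)
    qed
  qed
  then have "filterlim (\<lambda>m. real ((m - 1) div k)) at_top sequentially"
    by (rule filterlim_compose[OF filterlim_real_sequentially])
  then have "filterlim (\<lambda>m. 2 + real ((m - 1) div k)) at_top sequentially"
    by (rule filterlim_tendsto_add_at_top[OF tendsto_const])
  then have "(\<lambda>m. pi / (2 + real ((m - 1) div k))) \<longlonglongrightarrow> 0"
    by (intro tendsto_divide_0[OF tendsto_const] filterlim_at_top_imp_at_infinity)
  then have "(\<lambda>m. cos (pi / (2 + real ((m - 1) div k)))) \<longlonglongrightarrow> cos 0"
    by (intro tendsto_intros)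
  then show ?thesis
    by (simp add: radius_coeff_eq add.commute)
qed

lemma radius_poly_mono:
  assumes "0 \<le> s" "s \<le> t"
  shows "radius_poly m s \<le> radius_poly m t"
  unfolding radius_poly_def using assms
  by (intro sum_mono mult_right_mono power_mono)
    (auto intro: order_trans[OF _ radius_coeff_bounds(1)])

lemma radius_poly_strict_mono:
  assumes "m \<ge> 2" "0 \<le> s" "s < t"
  shows "radius_poly m s < radius_poly m t"
  unfolding radius_poly_def
proof (rule sum_strict_mono)
  fix k assume "k \<in> {1..m-1}"
  then show "s ^ k * radius_coeff m k < t ^ k * radius_coeff m k"
    using assms radius_coeff_bounds(1)[of k m]
    by (intro mult_strict_right_mono power_strict_mono) auto
qed (use assms in auto)

lemma is_radius_iff: "is_radius m t \<longleftrightarrow> 0 < t \<and> t \<le> 1 \<and> radius_poly m t = 1/2"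
  by (simp add: is_radius_def radius_poly_def radius_coeff_def)

lemma ex1_is_radius:
  assumes "m \<ge> 2"
  shows "\<exists>!t. is_radius m t"
proof -
  have "continuous_on {0..1} (radius_poly m)"
    unfolding radius_poly_def by (intro continuous_intros)
  moreover have zero: "radius_poly m 0 = 0"
    by (simp add: radius_poly_def power_0_left)
  moreover have "1/2 \<le> radius_poly m 1"
  proof -
    have "1/2 \<le> radius_coeff m 1"
      using assms by (intro radius_coeff_bounds) auto
    also have "\<dots> \<le> radius_poly m 1"
      unfolding radius_poly_def power_one mult_1 using assms
      by (intro member_le_sum) (auto intro: order_trans[OF _ radius_coeff_bounds(1)])
    finally show ?thesis .
  qed
  ultimately obtain t where t: "0 \<le> t" "t \<le> 1" "radius_poly m t = 1/2"
    using IVT'[of "radius_poly m" 0 "1/2" 1] by auto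
  show ?thesis
  proof (rule ex1I)
    show "is_radius m t"
      using t zero by (cases "t = 0") (auto simp: is_radius_iff)
    fix s assume "is_radius m s"
    then show "s = t"
      using t radius_poly_strict_mono[OF assms, of s t] radius_poly_strict_mono[OF assms, of t s]
      by (cases s t rule: linorder_cases) (auto simp: is_radius_iff)
  qed
qed

lemma radius_root:
  assumes "m \<ge> 2"
  shows "0 < radius m" "radius m \<le> 1" "radius_poly m (radius m) = 1/2"
  using theI'[OF ex1_is_radius[OF assms]] by (auto simp: radius_def is_radius_iff)

lemma radius_less:
  assumes "m \<ge> 2" "0 \<le> t" "1/2 < radius_poly m t"
  shows "radius m < t"
  using radius_poly_mono[of t "radius m" m] radius_root(3)[OF assms(1)] assms(2,3) by fastforce

lemma radius_strict_antimono: "strict_antimono_on {2..} radius"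
proof (rule monotone_onI)
  fix m m' :: nat
  assume m: "m \<in> {2..}" "m < m'"
  let ?t = "radius m"
  have t: "0 < ?t"
    using radius_root m by simp
  have "1/2 = radius_poly m ?t"
    using radius_root m by simp
  also have "\<dots> \<le> (\<Sum>k=1..m-1. ?t ^ k * radius_coeff m' k)"
    unfolding radius_poly_def using t m
    by (intro sum_mono mult_left_mono radius_coeff_mono) auto
  also have "\<dots> < radius_poly m' ?t"
    unfolding radius_poly_def
  proof (rule sum_strict_mono2)
    show "m' - 1 \<in> {1..m'-1} - {1..m-1}"
      using m by auto
    show "0 < ?t ^ (m' - 1) * radius_coeff m' (m' - 1)"
      using t m radius_coeff_bounds(1)[of "m' - 1" m']
      by (intro mult_pos_pos zero_less_power) force+
    show "0 \<le> ?t ^ k * radius_coeff m' k" if "k \<in> {1..m'-1}" for k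
      using t that radius_coeff_bounds(1)[of k m'] by auto
  qed (use m in auto)
  finally show "radius m > radius m'"
    using m t by (intro radius_less) auto
qed

lemma radius_gt_third:
  assumes "m \<ge> 2"
  shows "1/3 < radius m"
proof (rule ccontr)
  assume "\<not> 1/3 < radius m"
  then have "1/2 \<le> radius_poly m (1/3)"
    using radius_poly_mono[of "radius m" "1/3" m] radius_root[OF assms] by simp
  also have "\<dots> < (\<Sum>k=1..m-1. (1/3) ^ k)"
    unfolding radius_poly_def
  proof (rule sum_strict_mono)
    fix k assume "k \<in> {1..m-1}"
    then show "(1/3) ^ k * radius_coeff m k < (1/3) ^ k"
      using radius_coeff_bounds(2)[of k m] by simp
  qed (use assms in auto)
  also have "\<dots> \<le> 1/2"
  proof -
    have "2 * (\<Sum>k=1..p. (1/3) ^ k) = 1 - (1/3 :: real) ^ p" for p :: nat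
    proof (induction p)
      case (Suc p)
      have "(1/3 :: real) ^ Suc p = (1/3) ^ p / 3"
        by simp
      with Suc show ?case
        by (simp add: algebra_simps)
    qed simp
    from this[of "m - 1"] show ?thesis
      using zero_le_power[of "1/3 :: real" "m - 1"] by linarith
  qed
  finally show False by simp
qed

lemma radius_tendsto: "radius \<longlonglongrightarrow> 1/3"
proof (rule order_tendstoI)
  fix a :: real
  assume "a < 1/3"
  then show "\<forall>\<^sub>F m in sequentially. a < radius m"
    using radius_gt_third
    by (intro eventually_mono[OF eventually_ge_at_top[of 2]]) fastforce
next
  fix a :: real
  assume "1/3 < a"
  define t where "t = min a (1/2)"
  have t: "1/3 < t" "t < 1" "t \<le> a"
    using \<open>1/3 < a\<close> by (auto simp: t_def)
  have "(\<lambda>K. \<Sum>k<K. t ^ Suc k) \<longlonglongrightarrow> (1 / (1 - t) - 1)"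
    using geometric_sums[of t] sums_Suc_iff[of "\<lambda>k. t ^ k" "1 / (1 - t) - 1"] t
    by (simp add: sums_def)
  moreover have "1/2 < 1 / (1 - t) - 1"
    using t by (simp add: field_simps)
  ultimately have "\<forall>\<^sub>F K in sequentially. 1/2 < (\<Sum>k<K. t ^ Suc k)"
    by (rule order_tendstoD(1))
  then obtain K where K: "1/2 < (\<Sum>k<K. t ^ Suc k)"
    by (auto simp: eventually_sequentially)
  have "(\<lambda>m. \<Sum>k<K. t ^ Suc k * radius_coeff m (Suc k)) \<longlonglongrightarrow> (\<Sum>k<K. t ^ Suc k * 1)"
    by (intro tendsto_intros radius_coeff_tendsto) simp
  then have "\<forall>\<^sub>F m in sequentially. 1/2 < (\<Sum>k<K. t ^ Suc k * radius_coeff m (Suc k))"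
    using K by (intro order_tendstoD(1)) auto
  then show "\<forall>\<^sub>F m in sequentially. radius m < a"
    using eventually_ge_at_top[of "K + 2"]
  proof eventually_elim
    case (elim m)
    have "(\<Sum>k<K. t ^ Suc k * radius_coeff m (Suc k)) = (\<Sum>k\<in>{1..K}. t ^ k * radius_coeff m k)"
      by (rule sum.reindex_bij_witness[of _ "\<lambda>k. k - 1" Suc]) auto
    also have "\<dots> \<le> radius_poly m t"
      unfolding radius_poly_def using elim(2) t
      by (intro sum_mono2) (auto intro!: mult_nonneg_nonneg intro: order_trans[OF _ radius_coeff_bounds(1)])
    finally have "radius m < t"
      using elim t by (intro radius_less) auto
    then show ?case
      using t by simp
  qed
qed

section \<open>Joint numerical radii\<close>

lemma ell2_translate_norm:
  assumes \<alpha>: "\<alpha> \<in> lists J" and f: "f \<in> ell2 (lists J)"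
  shows "(\<lambda>v. (norm (f (\<alpha> @ v)))\<^sup>2) summable_on lists J"
    and "(\<Sum>\<^sub>\<infinity>v\<in>lists J. (norm (f (\<alpha> @ v)))\<^sup>2) \<le> (ell2_norm (lists J) f)\<^sup>2"
proof -
  have sub: "(@) \<alpha> ` lists J \<subseteq> lists J"
    using \<alpha> by auto
  have inj: "inj_on ((@) \<alpha>) (lists J)"
    by (auto simp: inj_on_def)
  have sum: "(\<lambda>w. (norm (f w))\<^sup>2) summable_on (@) \<alpha> ` lists J"
    by (rule summable_on_subset_banach[OF ell2_summable[OF f] sub])
  then show "(\<lambda>v. (norm (f (\<alpha> @ v)))\<^sup>2) summable_on lists J"
    by (simp add: summable_on_reindex[OF inj] o_def)
  have "(\<Sum>\<^sub>\<infinity>v\<in>lists J. (norm (f (\<alpha> @ v)))\<^sup>2) = (\<Sum>\<^sub>\<infinity>w\<in>(@) \<alpha> ` lists J. (norm (f w))\<^sup>2)"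
    by (simp add: infsum_reindex[OF inj] o_def)
  also have "\<dots> \<le> (ell2_norm (lists J) f)\<^sup>2"
    unfolding ell2_norm_square
    by (rule infsum_mono2[OF sum ell2_summable[OF f] sub]) simp
  finally show "(\<Sum>\<^sub>\<infinity>v\<in>lists J. (norm (f (\<alpha> @ v)))\<^sup>2) \<le> (ell2_norm (lists J) f)\<^sup>2" .
qed

lemma word_form_summable_bound:
  assumes X: "bounded_linear X" and \<alpha>: "\<alpha> \<in> lists J" and f: "f \<in> ell2 (lists J)"
  shows "(\<lambda>v. cmod (cinner (X (f v)) (f (\<alpha> @ v)))) summable_on lists J"
    and "cmod (word_form J \<alpha> X f) \<le> onorm X * (ell2_norm (lists J) f)\<^sup>2"
proof -
  let ?g = "\<lambda>v. onorm X / 2 * ((norm (f v))\<^sup>2 + (norm (f (\<alpha> @ v)))\<^sup>2)"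
  have g: "?g summable_on lists J"
    by (intro summable_on_cmult_right summable_on_add ell2_summable[OF f]
        ell2_translate_norm(1)[OF \<alpha> f])
  have le: "cmod (cinner (X (f v)) (f (\<alpha> @ v))) \<le> ?g v" for v
  proof -
    have "cmod (cinner (X (f v)) (f (\<alpha> @ v))) \<le> norm (X (f v)) * norm (f (\<alpha> @ v))"
      by (rule cinner_Cauchy_Schwarz)
    also have "\<dots> \<le> onorm X * norm (f v) * norm (f (\<alpha> @ v))"
      by (intro mult_right_mono onorm[OF X]) simp
    also have "\<dots> = onorm X * (norm (f v) * norm (f (\<alpha> @ v)))"
      by simp
    also have "\<dots> \<le> onorm X * (((norm (f v))\<^sup>2 + (norm (f (\<alpha> @ v)))\<^sup>2) / 2)"
      using zero_le_power2[of "norm (f v) - norm (f (\<alpha> @ v))"]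
      by (intro mult_left_mono onorm_pos_le[OF X]) (simp add: power2_diff)
    finally show ?thesis
      by simp
  qed
  show sum: "(\<lambda>v. cmod (cinner (X (f v)) (f (\<alpha> @ v)))) summable_on lists J"
    by (rule summable_on_comparison_test[OF g le]) simp
  have "cmod (word_form J \<alpha> X f) \<le> (\<Sum>\<^sub>\<infinity>v\<in>lists J. cmod (cinner (X (f v)) (f (\<alpha> @ v))))"
    unfolding word_form_def by (rule norm_infsum_bound[OF sum])
  also have "\<dots> \<le> infsum ?g (lists J)"
    by (rule infsum_mono[OF sum g le])
  also have "\<dots> = onorm X / 2 *
      ((ell2_norm (lists J) f)\<^sup>2 + (\<Sum>\<^sub>\<infinity>v\<in>lists J. (norm (f (\<alpha> @ v)))\<^sup>2))"
    unfolding ell2_norm_square infsum_cmult_right'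
    by (subst infsum_add[OF ell2_summable[OF f] ell2_translate_norm(1)[OF \<alpha> f]]) (rule refl)
  also have "\<dots> \<le> onorm X / 2 * ((ell2_norm (lists J) f)\<^sup>2 + (ell2_norm (lists J) f)\<^sup>2)"
    using onorm_pos_le[OF X] by (intro mult_left_mono add_left_mono ell2_translate_norm(2)[OF \<alpha> f]) simp
  finally show "cmod (word_form J \<alpha> X f) \<le> onorm X * (ell2_norm (lists J) f)\<^sup>2"
    by simp
qed

lemma joint_numerical_radius_le:
  fixes A :: "'j \<Rightarrow> 'a::chilbert_space \<Rightarrow> 'a"
  assumes A: "\<And>j. j \<in> J \<Longrightarrow> bounded_clinear (A j)" and "0 \<le> B"
    and le: "\<And>h. h \<in> ell2 (lists J) \<Longrightarrow> ell2_norm (lists J) h = 1 \<Longrightarrow>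
      cmod (\<Sum>j\<in>J. word_form J [j] (A j) h) \<le> B"
  shows "joint_numerical_radius J (\<lambda>j. cadjoint (A j)) \<le> B"
  unfolding joint_numerical_radius_def numerical_radius_def
proof (rule cSup_least)
  fix x
  assume "x \<in> insert 0 {cmod (ell2_inner (lists J) (\<lambda>w. \<Sum>j\<in>J. tensor_op (lists J) (creation j)
      (cadjoint (cadjoint (A j))) h w) h) |h. h \<in> ell2 (lists J) \<and> ell2_norm (lists J) h = 1}"
  then consider "x = 0" | h where "h \<in> ell2 (lists J)" "ell2_norm (lists J) h = 1"
    "x = cmod (ell2_inner (lists J) (\<lambda>w. \<Sum>j\<in>J. tensor_op (lists J) (creation j)
      (cadjoint (cadjoint (A j))) h w) h)"
    by blast
  then show "x \<le> B"
  proof cases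
    case 1
    then show ?thesis
      using \<open>0 \<le> B\<close> by simp
  next
    case (2 h)
    have creation: "creation j = creation_word [j]" for j :: 'j
      by (simp add: fun_eq_iff)
    have "(\<lambda>w. \<Sum>j\<in>J. tensor_op (lists J) (creation j) (cadjoint (cadjoint (A j))) h w) =
        (\<lambda>w. \<Sum>j\<in>J. word_shift [j] (A j) h w)"
      by (intro ext sum.cong refl)
        (simp only: creation cadjoint_cadjoint[OF A] tensor_op_eq_word_shift[OF A 2(1)])
    then have "x = cmod (\<Sum>j\<in>J. ell2_inner (lists J) (word_shift [j] (A j) h) h)"
      unfolding 2(3) by (simp only:, subst ell2_inner_sum_left) (auto intro!: word_shift_ell2 A 2(1))
    also have "(\<Sum>j\<in>J. ell2_inner (lists J) (word_shift [j] (A j) h) h) =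
        (\<Sum>j\<in>J. word_form J [j] (A j) h)"
      unfolding word_form_def
      by (intro sum.cong refl ell2_inner_word_shift A 2(1)) auto
    finally show ?thesis
      using le[OF 2(1,2)] by simp
  qed
qed simp

definition rotation :: "real \<Rightarrow> ('j list \<Rightarrow> 'a::complex_inner) \<Rightarrow> 'j list \<Rightarrow> 'a"
  where "rotation s f w = cis (s * real (length w)) *\<^sub>C f w"

lemma norm_rotation [simp]: "norm (rotation s f w) = norm (f w)"
  by (simp add: rotation_def norm_scaleC)

lemma rotation_eq_zero_iff: "rotation s f w = 0 \<longleftrightarrow> f w = 0"
  using norm_rotation[of s f w] norm_eq_zero[of "rotation s f w"] norm_eq_zero[of "f w"] by argo

lemma rotation_ell2: "f \<in> ell2 I \<Longrightarrow> rotation s f \<in> ell2 I"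
  by (simp add: ell2_def rotation_eq_zero_iff)

lemma ell2_norm_rotation: "ell2_norm I (rotation s f) = ell2_norm I f"
  by (simp add: ell2_norm_def)

lemma word_form_rotation:
  assumes "bounded_clinear X"
  shows "word_form J \<alpha> X (rotation s f) = cis (- (s * real (length \<alpha>))) * word_form J \<alpha> X f"
proof -
  have "cinner (X (rotation s f v)) (rotation s f (\<alpha> @ v)) =
      cis (- (s * real (length \<alpha>))) * cinner (X (f v)) (f (\<alpha> @ v))" for v
  proof -
    have "cis (s * real (length v)) * cnj (cis (s * real (length (\<alpha> @ v)))) =
        cis (- (s * real (length \<alpha>)))"
      by (simp add: cis_cnj cis_mult algebra_simps)
    moreover have "cinner (X (rotation s f v)) (rotation s f (\<alpha> @ v)) =
        (cis (s * real (length v)) * cnj (cis (s * real (length (\<alpha> @ v))))) *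
          cinner (X (f v)) (f (\<alpha> @ v))"
      using assms unfolding rotation_def bounded_clinear_def
      by (simp only: cinner_scaleC_left cinner_scaleC_right mult_ac)
    ultimately show ?thesis
      by (simp only:)
  qed
  then show ?thesis
    by (simp add: word_form_def infsum_cmult_right')
qed

lemma inj_on_concat_words:
  assumes "k \<ge> 1"
  shows "inj_on concat (lists (words n k))"
proof (rule inj_onI)
  have len: "length (concat V) = k * length V" if "V \<in> lists (words n k)" for V
    using that by (induction V) (auto simp: words_def)
  fix V W
  assume V: "V \<in> lists (words n k)" and W: "W \<in> lists (words n k)" and eq: "concat V = concat W"
  have "length V = length W"
    using len[OF V] len[OF W] assms eq by simp
  moreover have "\<forall>(x, y)\<in>set (zip V W). length x = length y"
  proof clarify
    fix x y assume "(x, y) \<in> set (zip V W)"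
    then have "x \<in> words n k" "y \<in> words n k"
      using V W by (meson in_listsD set_zip_leftD set_zip_rightD)+
    then show "length x = length y"
      by (simp add: words_def)
  qed
  ultimately show "V = W"
    using eq by (intro concat_injective)
qed

definition lift_words :: "nat \<Rightarrow> nat \<Rightarrow> (nat list list \<Rightarrow> 'a::zero) \<Rightarrow> nat list \<Rightarrow> 'a"
  where "lift_words n k h w = (if w \<in> concat ` lists (words n k)
    then h (inv_into (lists (words n k)) concat w) else 0)"

lemma lift_words_concat:
  "k \<ge> 1 \<Longrightarrow> V \<in> lists (words n k) \<Longrightarrow> lift_words n k h (concat V) = h V"
  by (simp add: lift_words_def inv_into_f_f inj_on_concat_words)

lemma lift_words_outside: "w \<notin> concat ` lists (words n k) \<Longrightarrow> lift_words n k h w = 0"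
  by (simp add: lift_words_def)

lemma lift_words_not_dvd:
  assumes "\<not> k dvd length w"
  shows "lift_words n k h w = 0"
proof (rule lift_words_outside)
  have "k dvd length (concat V)" if "V \<in> lists (words n k)" for V
    using that by (induction V) (auto simp: words_def)
  with assms show "w \<notin> concat ` lists (words n k)"
    by auto
qed

lemma concat_words_subset: "concat ` lists (words n k) \<subseteq> lists {1..n}"
  by (force simp: words_def)

lemma lift_words_ell2:
  assumes k: "k \<ge> 1" and h: "h \<in> ell2 (lists (words n k))"
  shows "lift_words n k h \<in> ell2 (lists {1..n})"
    and "ell2_norm (lists {1..n}) (lift_words n k h) = ell2_norm (lists (words n k)) h"
proof -
  let ?L = "lists (words n k)" and ?f = "lift_words n k h"
  have "(\<lambda>V. (norm (?f (concat V)))\<^sup>2) summable_on ?L"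
    using ell2_summable[OF h] by (rule summable_on_cong[THEN iffD1, rotated]) (simp add: lift_words_concat[OF k])
  then have "(\<lambda>w. (norm (?f w))\<^sup>2) summable_on concat ` ?L"
    by (simp add: summable_on_reindex[OF inj_on_concat_words[OF k]] o_def)
  then have "(\<lambda>w. (norm (?f w))\<^sup>2) summable_on lists {1..n}"
    by (rule summable_on_cong_neutral[THEN iffD1, rotated -1])
      (use concat_words_subset[of n k] in \<open>auto simp: lift_words_outside\<close>)
  moreover have "?f w = 0" if "w \<notin> lists {1..n}" for w
    using that concat_words_subset[of n k] by (intro lift_words_outside) blast
  ultimately show "?f \<in> ell2 (lists {1..n})"
    by (simp add: ell2_def)
  have "(\<Sum>\<^sub>\<infinity>w\<in>lists {1..n}. (norm (?f w))\<^sup>2) = (\<Sum>\<^sub>\<infinity>w\<in>concat ` ?L. (norm (?f w))\<^sup>2)"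
    by (rule infsum_cong_neutral)
      (use concat_words_subset[of n k] in \<open>auto simp: lift_words_outside\<close>)
  also have "\<dots> = (\<Sum>\<^sub>\<infinity>V\<in>?L. (norm (?f (concat V)))\<^sup>2)"
    by (simp add: infsum_reindex[OF inj_on_concat_words[OF k]] o_def)
  also have "\<dots> = (\<Sum>\<^sub>\<infinity>V\<in>?L. (norm (h V))\<^sup>2)"
    by (rule infsum_cong) (simp add: lift_words_concat[OF k])
  finally show "ell2_norm (lists {1..n}) ?f = ell2_norm ?L h"
    by (simp add: ell2_norm_def)
qed

lemma word_form_lift_words:
  assumes k: "k \<ge> 1" and X: "bounded_clinear X" and \<alpha>: "\<alpha> \<in> words n k"
  shows "word_form {1..n} \<alpha> X (lift_words n k h) = word_form (words n k) [\<alpha>] X h"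
proof -
  let ?L = "lists (words n k)" and ?f = "lift_words n k h"
  have "word_form {1..n} \<alpha> X ?f = (\<Sum>\<^sub>\<infinity>v\<in>concat ` ?L. cinner (X (?f v)) (?f (\<alpha> @ v)))"
    unfolding word_form_def
    by (rule infsum_cong_neutral)
      (use concat_words_subset[of n k] in
        \<open>auto simp: lift_words_outside bounded_clinear_zero[OF X] cinner.zero_left\<close>)
  also have "\<dots> = (\<Sum>\<^sub>\<infinity>V\<in>?L. cinner (X (?f (concat V))) (?f (\<alpha> @ concat V)))"
    by (simp add: infsum_reindex[OF inj_on_concat_words[OF k]] o_def)
  also have "\<dots> = (\<Sum>\<^sub>\<infinity>V\<in>?L. cinner (X (h V)) (h ([\<alpha>] @ V)))"
  proof (rule infsum_cong)
    fix V assume V: "V \<in> ?L"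
    then have "?f (concat (\<alpha> # V)) = h (\<alpha> # V)"
      using \<alpha> by (intro lift_words_concat[OF k]) auto
    then show "cinner (X (?f (concat V))) (?f (\<alpha> @ concat V)) = cinner (X (h V)) (h ([\<alpha>] @ V))"
      using V by (simp add: lift_words_concat[OF k])
  qed
  finally show ?thesis
    by (simp add: word_form_def)
qed

lemma word_form_lift_words_not_dvd:
  assumes X: "bounded_clinear X" and "\<not> k dvd length \<alpha>"
  shows "word_form J \<alpha> X (lift_words n k h) = 0"
proof -
  have "cinner (X (lift_words n k h v)) (lift_words n k h (\<alpha> @ v)) = 0" for v
  proof (cases "k dvd length v")
    case True
    with assms(2) have "\<not> k dvd length (\<alpha> @ v)"
      by (simp add: dvd_add_left_iff)
    then have "lift_words n k h (\<alpha> @ v) = 0"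
      by (rule lift_words_not_dvd)
    then show ?thesis
      by (simp only: cinner.zero_right)
  next
    case False
    then have "lift_words n k h v = 0"
      by (rule lift_words_not_dvd)
    then show ?thesis
      by (simp only: bounded_clinear_zero[OF X] cinner.zero_left)
  qed
  then show ?thesis
    by (simp add: word_form_def)
qed

lemma norm_minus_word_form_le:
  assumes X: "bounded_linear X" and f: "f \<in> ell2 (lists J)"
  shows "(ell2_norm (lists J) f)\<^sup>2 - Re (word_form J [] X f) \<le>
    onorm (\<lambda>x. x - X x) * (ell2_norm (lists J) f)\<^sup>2"
proof -
  have D: "bounded_linear (\<lambda>x. x - X x)"
    by (intro bounded_linear_sub bounded_linear_ident X)
  have summable: "(\<lambda>v. cinner (Y (f v)) (f v)) summable_on lists J" if "bounded_linear Y" for Y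
  proof (rule abs_summable_summable)
    show "(\<lambda>v. cmod (cinner (Y (f v)) (f v))) summable_on lists J"
      using word_form_summable_bound(1)[OF that _ f, of "[]"] by simp
  qed
  have "word_form J [] X f + word_form J [] (\<lambda>x. x - X x) f =
      (\<Sum>\<^sub>\<infinity>v\<in>lists J. cinner (X (f v)) (f v) + cinner (f v - X (f v)) (f v))"
    unfolding word_form_def append_Nil by (rule infsum_add[OF summable[OF X] summable[OF D], symmetric])
  also have "\<dots> = ell2_inner (lists J) f f"
    by (simp add: ell2_inner_def cinner.diff_left)
  finally have split: "word_form J [] X f + word_form J [] (\<lambda>x. x - X x) f =
      ell2_inner (lists J) f f" .
  from arg_cong[OF split, of Re] have "(ell2_norm (lists J) f)\<^sup>2 - Re (word_form J [] X f) =
      Re (word_form J [] (\<lambda>x. x - X x) f)"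
    by (simp add: ell2_inner_self[OF f])
  also have "\<dots> \<le> cmod (word_form J [] (\<lambda>x. x - X x) f)"
    by (rule complex_Re_le_cmod)
  also have "\<dots> \<le> onorm (\<lambda>x. x - X x) * (ell2_norm (lists J) f)\<^sup>2"
    by (rule word_form_summable_bound(2)[OF D _ f]) simp
  finally show ?thesis .
qed

lemma sum_multiples:
  fixes g :: "nat \<Rightarrow> 'a::comm_monoid_add"
  assumes k: "k \<ge> 1" and zero: "\<And>j. \<not> k dvd j \<Longrightarrow> g j = 0"
  shows "(\<Sum>j=1..p. g j) = (\<Sum>l=1..p div k. g (l * k))"
proof -
  have "(\<Sum>l=1..p div k. g (l * k)) = sum g ((\<lambda>l. l * k) ` {1..p div k})"
    using k by (subst sum.reindex) (auto simp: inj_on_def)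
  also have "\<dots> = (\<Sum>j=1..p. g j)"
  proof (rule sum.mono_neutral_left)
    show "(\<lambda>l. l * k) ` {1..p div k} \<subseteq> {1..p}"
      using k by (auto simp: less_eq_div_iff_mult_less_eq)
    show "\<forall>j\<in>{1..p} - (\<lambda>l. l * k) ` {1..p div k}. g j = 0"
    proof
      fix j assume j: "j \<in> {1..p} - (\<lambda>l. l * k) ` {1..p div k}"
      have "\<not> k dvd j"
      proof
        assume "k dvd j"
        then obtain l where "j = l * k"
          by (metis dvd_div_mult_self)
        with j k show False
          by (auto simp: less_eq_div_iff_mult_less_eq image_iff)
      qed
      then show "g j = 0"
        by (rule zero)
    qed
  qed simp
  finally show ?thesis ..
qed

context
  fixes n m :: nat and A :: "nat list \<Rightarrow> 'a::chilbert_space \<Rightarrow> 'a"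
  assumes A: "\<And>k \<alpha>. k \<in> {0..m-1} \<Longrightarrow> \<alpha> \<in> words n k \<Longrightarrow> bounded_clinear (A \<alpha>)"
    and le: "ell2_le (lists {1..n}) (ell2_Re (lists {1..n}) (fock_poly n m A)) id"
begin

lemma bounded_clinear_A0: "bounded_clinear (A [])"
  by (rule A[of 0]) (auto simp: words_def)

lemma homogeneous_part_bound:
  assumes k: "1 \<le> k" "k \<le> m - 1" and h: "h \<in> ell2 (lists (words n k))"
    and norm: "ell2_norm (lists (words n k)) h = 1"
  shows "cmod (\<Sum>\<alpha>\<in>words n k. word_form (words n k) [\<alpha>] (A \<alpha>) h) \<le>
    2 * onorm (\<lambda>x. x - A [] x) * radius_coeff m k"
proof -
  define f where "f = lift_words n k h"
  define c where "c j = (\<Sum>\<alpha>\<in>words n j. word_form {1..n} \<alpha> (A \<alpha>) f)" for j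
  have f: "f \<in> ell2 (lists {1..n})" "ell2_norm (lists {1..n}) f = 1"
    using lift_words_ell2[OF k(1) h] norm by (auto simp: f_def)
  have c_zero: "c j = 0" if "j \<in> {1..m-1}" "\<not> k dvd j" for j
    unfolding c_def f_def using that
    by (intro sum.neutral ballI word_form_lift_words_not_dvd A[of j]) (auto simp: words_def)
  have "onorm (\<lambda>x. x - A [] x) - Re (\<Sum>l=1..(m-1) div k. cis (real l * \<theta>) * c (l * k)) \<ge> 0" for \<theta>
  proof -
    define s where "s = - \<theta> / real k"
    have "(\<Sum>j=0..m-1. \<Sum>\<alpha>\<in>words n j. word_form {1..n} \<alpha> (A \<alpha>) (rotation s f)) =
        (\<Sum>j=0..m-1. cis (- (s * real j)) * c j)"
      unfolding c_def sum_distrib_left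
    proof (intro sum.cong refl)
      fix j \<alpha> assume j: "j \<in> {0..m-1}" "\<alpha> \<in> words n j"
      then have "length \<alpha> = j"
        by (simp add: words_def)
      then show "word_form {1..n} \<alpha> (A \<alpha>) (rotation s f) =
          cis (- (s * real j)) * word_form {1..n} \<alpha> (A \<alpha>) f"
        by (simp only: word_form_rotation[OF A[OF j]])
    qed
    also have "\<dots> = c 0 + (\<Sum>j=1..m-1. cis (- (s * real j)) * c j)"
      by (simp add: sum.atLeast_Suc_atMost)
    also have "c 0 = word_form {1..n} [] (A []) f"
    proof -
      have "words n 0 = {[]}"
        by (auto simp: words_def)
      then show ?thesis
        by (simp add: c_def)
    qed
    also have "(\<Sum>j=1..m-1. cis (- (s * real j)) * c j) =
        (\<Sum>j=1..m-1. if k dvd j then cis (- (s * real j)) * c j else 0)"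
      by (intro sum.cong refl) (simp add: c_zero)
    also have "\<dots> = (\<Sum>l=1..(m-1) div k. cis (real l * \<theta>) * c (l * k))"
      using k by (subst sum_multiples[OF k(1)]) (auto simp: s_def mult.commute intro!: sum.cong)
    finally have sum_eq: "(\<Sum>j=0..m-1. \<Sum>\<alpha>\<in>words n j. word_form {1..n} \<alpha> (A \<alpha>) (rotation s f)) =
        word_form {1..n} [] (A []) f + (\<Sum>l=1..(m-1) div k. cis (real l * \<theta>) * c (l * k))" .
    have "Re (\<Sum>j=0..m-1. \<Sum>\<alpha>\<in>words n j. word_form {1..n} \<alpha> (A \<alpha>) (rotation s f)) \<le>
        (ell2_norm (lists {1..n}) (rotation s f))\<^sup>2"
      by (rule word_forms_le_norm[OF _ le rotation_ell2[OF f(1)]]) (rule A)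
    then have "Re (word_form {1..n} [] (A []) f) +
        Re (\<Sum>l=1..(m-1) div k. cis (real l * \<theta>) * c (l * k)) \<le> 1"
      unfolding sum_eq ell2_norm_rotation f(2) by (simp only: plus_complex.sel power_one)
    moreover have "1 - Re (word_form {1..n} [] (A []) f) \<le> onorm (\<lambda>x. x - A [] x)"
      using norm_minus_word_form_le[OF
          conjunct1[OF bounded_clinear_A0[unfolded bounded_clinear_def]] f(1)]
      unfolding f(2) by simp
    ultimately show ?thesis
      by simp
  qed
  moreover have "1 \<le> (m - 1) div k"
    using k by (simp add: div_greater_zero_iff Suc_leI)
  ultimately have "cmod (c (1 * k)) \<le>
      2 * onorm (\<lambda>x. x - A [] x) * cos (pi / (real ((m - 1) div k) + 2))"
    by (intro Fejer_coefficient_bound[where c = "\<lambda>l. c (l * k)"])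
  moreover have "c k = (\<Sum>\<alpha>\<in>words n k. word_form (words n k) [\<alpha>] (A \<alpha>) h)"
    unfolding c_def f_def using k by (intro sum.cong refl word_form_lift_words A[of k]) auto
  ultimately show ?thesis
    by (simp add: radius_coeff_eq)
qed

lemma joint_numerical_radius_homogeneous_part:
  assumes k: "1 \<le> k" "k \<le> m - 1"
  shows "joint_numerical_radius (words n k) (\<lambda>\<alpha>. cadjoint (A \<alpha>)) \<le>
    2 * onorm (\<lambda>x. x - A [] x) * radius_coeff m k"
proof (rule joint_numerical_radius_le)
  have "bounded_linear (\<lambda>x. x - A [] x)"
    using bounded_clinear_A0
    by (intro bounded_linear_sub bounded_linear_ident) (simp add: bounded_clinear_def)
  then show "0 \<le> 2 * onorm (\<lambda>x. x - A [] x) * radius_coeff m k"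
    using radius_coeff_bounds(1)[OF k] by (simp add: onorm_pos_le)
  show "bounded_clinear (A \<alpha>)" if "\<alpha> \<in> words n k" for \<alpha>
    using that k by (intro A[of k]) auto
qed (rule homogeneous_part_bound[OF k])

lemma joint_numerical_radius_constant_part:
  "joint_numerical_radius (words n 0) (\<lambda>\<alpha>. cadjoint (A \<alpha>)) \<le> onorm (A [])"
proof (rule joint_numerical_radius_le)
  have words: "words n 0 = {[]}"
    by (auto simp: words_def)
  have A0: "bounded_linear (A [])"
    using bounded_clinear_A0 by (simp add: bounded_clinear_def)
  then show "0 \<le> onorm (A [])"
    by (rule onorm_pos_le)
  show "bounded_clinear (A \<alpha>)" if "\<alpha> \<in> words n 0" for \<alpha>
    using that by (intro A[of 0]) auto
  show "cmod (\<Sum>\<alpha>\<in>words n 0. word_form (words n 0) [\<alpha>] (A \<alpha>) h) \<le> onorm (A [])"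
    if "h \<in> ell2 (lists (words n 0))" "ell2_norm (lists (words n 0)) h = 1" for h
    using word_form_summable_bound(2)[OF A0 _ that(1), of "[[]]"] that(2) by (simp add: words)
qed

lemma weighted_sum_bound:
  assumes m: "m \<ge> 2" and r: "r \<in> {0..radius m}"
  shows "(\<Sum>k=0..m-1. r ^ k * joint_numerical_radius (words n k) (\<lambda>\<alpha>. cadjoint (A \<alpha>)))
    \<le> onorm (A []) + onorm (\<lambda>x. x - A [] x)"
proof -
  let ?w = "\<lambda>k. joint_numerical_radius (words n k) (\<lambda>\<alpha>. cadjoint (A \<alpha>))"
  let ?D = "onorm (\<lambda>x. x - A [] x)"
  have "bounded_linear (\<lambda>x. x - A [] x)"
    using bounded_clinear_A0
    by (intro bounded_linear_sub bounded_linear_ident) (simp add: bounded_clinear_def)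
  then have D: "0 \<le> ?D"
    by (rule onorm_pos_le)
  have "(\<Sum>k=0..m-1. r ^ k * ?w k) = ?w 0 + (\<Sum>k=1..m-1. r ^ k * ?w k)"
    by (simp add: sum.atLeast_Suc_atMost)
  also have "\<dots> \<le> onorm (A []) + (\<Sum>k=1..m-1. r ^ k * (2 * ?D * radius_coeff m k))"
    using r by (intro add_mono joint_numerical_radius_constant_part sum_mono mult_left_mono
        joint_numerical_radius_homogeneous_part) auto
  also have "(\<Sum>k=1..m-1. r ^ k * (2 * ?D * radius_coeff m k)) = 2 * ?D * radius_poly m r"
    by (simp add: radius_poly_def sum_distrib_left mult_ac)
  also have "\<dots> \<le> 2 * ?D * radius_poly m (radius m)"
    using r D by (intro mult_left_mono radius_poly_mono) auto
  also have "\<dots> = ?D"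
    using radius_root(3)[OF m] by simp
  finally show ?thesis
    by simp
qed

end

theorem theorem2p10:
  shows "(\<forall>(n::nat) (m::nat) (A :: nat list \<Rightarrow> 'a::chilbert_space \<Rightarrow> 'a).
            n \<ge> 1 \<longrightarrow> m \<ge> 2 \<longrightarrow>
            (\<forall>k\<le>m-1. \<forall>\<alpha>\<in>words n k. bounded_clinear (A \<alpha>)) \<longrightarrow>
            positive_op (A []) \<longrightarrow>
            ell2_le (lists {1..n}) (ell2_Re (lists {1..n}) (fock_poly n m A)) id \<longrightarrow>
            (\<forall>r\<in>{0..radius m}.
              (\<Sum>k=0..m-1. r ^ k * joint_numerical_radius (words n k) (\<lambda>\<alpha>. cadjoint (A \<alpha>)))
                \<le> onorm (A []) + onorm (\<lambda>x. x - A [] x))) \<and>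
         (\<forall>m\<ge>2. \<exists>!t. is_radius m t) \<and>
         strict_antimono_on {2..} radius \<and>
         radius \<longlonglongrightarrow> 1/3"
proof (intro conjI allI impI ballI)
  fix n m :: nat and A :: "nat list \<Rightarrow> 'a \<Rightarrow> 'a" and r
  assume "m \<ge> 2" "\<forall>k\<le>m-1. \<forall>\<alpha>\<in>words n k. bounded_clinear (A \<alpha>)"
    "ell2_le (lists {1..n}) (ell2_Re (lists {1..n}) (fock_poly n m A)) id" "r \<in> {0..radius m}"
  then show "(\<Sum>k=0..m-1. r ^ k * joint_numerical_radius (words n k) (\<lambda>\<alpha>. cadjoint (A \<alpha>)))
      \<le> onorm (A []) + onorm (\<lambda>x. x - A [] x)"
    by (intro weighted_sum_bound) auto
qed (simp_all add: ex1_is_radius radius_strict_antimono radius_tendsto)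

end
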